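(* Let $\Omega\subset\mathbb{R}^n$ be a bounded uniform domain, $1<p<\infty$ and $0<s<1$. Then there exists a constant $C>1$ such that $$\inf_{{\bf r}\in RM}|{\bf u}-{\bf r}|_{W^{s,p}(\Omega)^n}\le C\,|{\bf u}|_{X^{s,p}(\Omega)^n}$$ for every vector field ${\bf u}\in W^{s,p}(\Omega)^n$.
   Context: A domain $D\subset\mathbb{R}^n$ is uniform if there is $c\ge1$ such that any $x_1,x_2\in D$ can be joined by a rectifiable arc $\gamma\subset D$ with $\ell(\gamma)\le c|x_1-x_2|$ and $\min\{\ell(\gamma(x_1,x)),\ell(\gamma(x,x_2))\}\le c\,d(x,\partial D)$ for all $x\in\gamma$, where $\ell$ is arc length and $\gamma(a,b)$ is the sub-arc between $a$ and $b$. $RM=\{{\bf r}(x)=Ax+b: A\in\mathbb{R}^{n\times n}\text{ skew-symmetric}, b\in\mathbb{R}^n\}$. $|{\bf u}|_{W^{s,p}(\Omega)^n}=\left(\int_\Omega\int_\Omega\frac{|{\bf u}(x)-{\bf u}(y)|^p}{|x-y|^{n+sp}}dx\,dy\right)^{1/p}$, $|{\bf u}|_{X^{s,p}(\Omega)^n}=\left(\int_\Omega\int_\Omega\frac{|({\bf u}(y)-{\bf u}(x))\cdot(y-x)|^p}{|y-x|^{n+sp+p}}dx\,dy\right)^{1/p}$, and $W^{s,p}(\Omega)^n$ is the space of ${\bf u}\in L^p(\Omega)^n$ with finite $W^{s,p}(\Omega)^n$ seminorm. *)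

theory Defs
  imports "HOL-Analysis.Analysis"
begin

definition curve_length :: "(real \<Rightarrow> 'a::metric_space) \<Rightarrow> real \<Rightarrow> real \<Rightarrow> ereal" where
  "curve_length g a b =
     (SUP ts \<in> {ts. ts \<noteq> [] \<and> sorted ts \<and> hd ts = a \<and> last ts = b}.
        ereal (\<Sum>i<length ts - 1. dist (g (ts ! i)) (g (ts ! Suc i))))"

definition uniform_domain :: "'a::euclidean_space set \<Rightarrow> real \<Rightarrow> bool" where
  "uniform_domain D c \<longleftrightarrow> open D \<and> connected D \<and> D \<noteq> {} \<and> c \<ge> 1 \<and>
     (\<forall>x1\<in>D. \<forall>x2\<in>D. x1 \<noteq> x2 \<longrightarrow>
        (\<exists>g. arc g \<and> pathstart g = x1 \<and> pathfinish g = x2 \<and> path_image g \<subseteq> D \<and>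
             curve_length g 0 1 \<le> ereal (c * dist x1 x2) \<and>
             (\<forall>t\<in>{0..1}. min (curve_length g 0 t) (curve_length g t 1)
                           \<le> ereal (c * infdist (g t) (frontier D)))))"

definition is_uniform_domain :: "'a::euclidean_space set \<Rightarrow> bool" where
  "is_uniform_domain D \<longleftrightarrow> (\<exists>c\<ge>1. uniform_domain D c)"

definition RM :: "((real^'n) \<Rightarrow> (real^'n)) set" where
  "RM = {r. \<exists>(A::real^'n^'n) b. transpose A = - A \<and> r = (\<lambda>x. A *v x + b)}"

definition W_seminorm :: "real \<Rightarrow> real \<Rightarrow> (real^'n) set \<Rightarrow> ((real^'n) \<Rightarrow> (real^'n)) \<Rightarrow> real" where
  "W_seminorm s p \<Omega> u =
     enn2real (\<integral>\<^sup>+ x\<in>\<Omega>. (\<integral>\<^sup>+ y\<in>\<Omega>.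
        ennreal (norm (u x - u y) powr p / dist x y powr (real CARD('n) + s * p)) \<partial>lebesgue) \<partial>lebesgue)
     powr (1 / p)"

definition X_seminorm :: "real \<Rightarrow> real \<Rightarrow> (real^'n) set \<Rightarrow> ((real^'n) \<Rightarrow> (real^'n)) \<Rightarrow> real" where
  "X_seminorm s p \<Omega> u =
     enn2real (\<integral>\<^sup>+ x\<in>\<Omega>. (\<integral>\<^sup>+ y\<in>\<Omega>.
        ennreal (\<bar>(u y - u x) \<bullet> (y - x)\<bar> powr p / dist y x powr (real CARD('n) + s * p + p)) \<partial>lebesgue) \<partial>lebesgue)
     powr (1 / p)"

definition Wsp :: "real \<Rightarrow> real \<Rightarrow> (real^'n) set \<Rightarrow> ((real^'n) \<Rightarrow> (real^'n)) set" where
  "Wsp s p \<Omega> = {u. u \<in> borel_measurable (lebesgue_on \<Omega>) \<and>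
      (\<integral>\<^sup>+ x\<in>\<Omega>. ennreal (norm (u x) powr p) \<partial>lebesgue) < \<infinity> \<and>
      (\<integral>\<^sup>+ x\<in>\<Omega>. (\<integral>\<^sup>+ y\<in>\<Omega>.
        ennreal (norm (u x - u y) powr p / dist x y powr (real CARD('n) + s * p)) \<partial>lebesgue) \<partial>lebesgue) < \<infinity>}"

end

theory Submission
  imports Defs
begin

text \<open>
  Write \<open>strain u x y = (u x - u y) \<bullet> (x - y)\<close>. For any three points
  \<open>(u x - u y) \<bullet> (x - w) = (u w - u y) \<bullet> (x - y) + strain u x w - strain u y w\<close>.
  The only geometry used is that a uniform domain contains, near each of its points \<open>x\<close> and at
  each small scale \<open>\<tau>\<close>, a ball of radius comparable to \<open>\<tau>\<close>. Averaging the identity over \<open>w\<close> in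
  such a ball at scale \<open>\<tau> = M * dist x y\<close> recovers the whole vector \<open>u x - u y\<close> and bounds
  the \<open>p\<close>-th power of the \<open>W\<close>-seminorm by \<open>C * M powr (s * p)\<close> times that of the
  \<open>X\<close>-seminorm, plus \<open>C * M powr (s * p - p)\<close> times itself, plus a multiple of the integral
  of \<open>norm (u x - u y) powr p\<close>. As \<open>s < 1\<close>, a large \<open>M\<close> lets the second term be absorbed.
  The last term is controlled after subtracting a rigid motion: the strains against \<open>y\<close> and the
  points \<open>y + \<rho> e\<^sub>i\<close> determine \<open>u\<close> up to an affine map with matrix \<open>L\<close>, and second
  differences of \<open>(L h) \<bullet> h\<close> show that the symmetric part of \<open>L\<close> is small.
\<close>

subsection \<open>Power sums and translation-invariant integration\<close>

text \<open>Every term is at most the largest one, which costs a factor \<open>card I\<close> inside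
  the power. This comparison does not go through convexity and so covers all exponents
  \<open>0 < p\<close>.\<close>

lemma powr_sum_le:
  fixes a :: "'i \<Rightarrow> real"
  assumes "finite I" and nonneg: "\<And>i. i \<in> I \<Longrightarrow> 0 \<le> a i" and "0 < p"
  shows "(\<Sum>i\<in>I. a i) powr p \<le> real (card I) powr p * (\<Sum>i\<in>I. a i powr p)"
proof (cases "I = {}")
  case False
  have fin: "finite (a ` I)" and ne: "a ` I \<noteq> {}" using assms(1) False by auto
  then obtain j where j: "j \<in> I" "a j = Max (a ` I)"
    using Max_in by (metis imageE)
  have le: "a i \<le> a j" if "i \<in> I" for i
    using that fin j by simp
  have "(\<Sum>i\<in>I. a i) \<le> real (card I) * a j"
    using sum_bounded_above[of I a "a j"] le by simp
  then have "(\<Sum>i\<in>I. a i) powr p \<le> (real (card I) * a j) powr p"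
    using assms(3) by (intro powr_mono2 sum_nonneg nonneg) auto
  also have "\<dots> = real (card I) powr p * a j powr p"
    using nonneg[OF j(1)] by (simp add: powr_mult)
  also have "\<dots> \<le> real (card I) powr p * (\<Sum>i\<in>I. a i powr p)"
    using j(1) assms(1) by (intro mult_left_mono member_le_sum) auto
  finally show ?thesis .
qed simp

lemma powr_add2_le:
  fixes a b p :: real
  assumes "0 \<le> a" "0 \<le> b" "0 < p"
  shows "(a + b) powr p \<le> 2 powr p * (a powr p + b powr p)"
proof -
  \<comment> \<open>Indexing a list presents the explicit summands as a family over an initial
    segment of the naturals, to which the general inequality applies.\<close>
  have "0 \<le> [a, b] ! i" if "i \<in> {..<2::nat}" for i
    using that assms by (auto simp: numeral_eq_Suc less_Suc_eq)
  from powr_sum_le[of "{..<2::nat}" "\<lambda>i. [a, b] ! i" p, OF finite_lessThan this \<open>0 < p\<close>]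
  show ?thesis
    by (simp add: numeral_eq_Suc add.assoc)
qed

lemma powr_add3_le:
  fixes a b c p :: real
  assumes "0 \<le> a" "0 \<le> b" "0 \<le> c" "0 < p"
  shows "(a + b + c) powr p \<le> 3 powr p * (a powr p + b powr p + c powr p)"
proof -
  have "0 \<le> [a, b, c] ! i" if "i \<in> {..<3::nat}" for i
    using that assms by (auto simp: numeral_eq_Suc less_Suc_eq)
  from powr_sum_le[of "{..<3::nat}" "\<lambda>i. [a, b, c] ! i" p, OF finite_lessThan this \<open>0 < p\<close>]
  show ?thesis
    by (simp add: numeral_eq_Suc add.assoc)
qed

lemma powr_add4_le:
  fixes a b c d p :: real
  assumes "0 \<le> a" "0 \<le> b" "0 \<le> c" "0 \<le> d" "0 < p"
  shows "(a + b + c + d) powr p \<le> 4 powr p * (a powr p + b powr p + c powr p + d powr p)"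
proof -
  have "0 \<le> [a, b, c, d] ! i" if "i \<in> {..<4::nat}" for i
    using that assms by (auto simp: numeral_eq_Suc less_Suc_eq)
  from powr_sum_le[of "{..<4::nat}" "\<lambda>i. [a, b, c, d] ! i" p, OF finite_lessThan this \<open>0 < p\<close>]
  show ?thesis
    by (simp add: numeral_eq_Suc add.assoc)
qed

lemma ball_measurable [measurable]: "ball x r \<in> sets borel"
  by simp

section \<open>Translation and averaging for nonnegative integrals\<close>

lemma nn_integral_lborel_translate:
  fixes f :: "'a::euclidean_space \<Rightarrow> ennreal"
  assumes [measurable]: "f \<in> borel_measurable borel"
  shows "(\<integral>\<^sup>+ x. f (x + h) \<partial>lborel) = (\<integral>\<^sup>+ x. f x \<partial>lborel)"
proof -
  have "(\<integral>\<^sup>+ x. f x \<partial>lborel) = (\<integral>\<^sup>+ x. f x \<partial>distr lborel borel ((+) h))"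
    by (simp add: lborel_distr_plus)
  also have "\<dots> = (\<integral>\<^sup>+ x. f (h + x) \<partial>lborel)"
    by (rule nn_integral_distr) simp_all
  finally show ?thesis by (simp add: add.commute)
qed

text \<open>Serves to bound an integral over a shifted small ball by the integral over a domain that
  contains the shifted ball.\<close>

lemma nn_integral_translate_subset:
  fixes f :: "'a::euclidean_space \<Rightarrow> ennreal"
  assumes [measurable]: "f \<in> borel_measurable borel" "S \<in> sets borel" "T \<in> sets borel"
    and "\<And>x. x \<in> S \<Longrightarrow> x + h \<in> T"
  shows "(\<integral>\<^sup>+ x\<in>S. f (x + h) \<partial>lborel) \<le> (\<integral>\<^sup>+ x\<in>T. f x \<partial>lborel)"
proof -
  have "(\<integral>\<^sup>+ x\<in>S. f (x + h) \<partial>lborel) \<le> (\<integral>\<^sup>+ x. f (x + h) * indicator T (x + h) \<partial>lborel)"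
    using assms(4) by (intro nn_integral_mono) (auto simp: indicator_def)
  also have "\<dots> = (\<integral>\<^sup>+ x\<in>T. f x \<partial>lborel)"
    by (rule nn_integral_lborel_translate[of "\<lambda>x. f x * indicator T x"]) simp
  finally show ?thesis .
qed

text \<open>If \<open>f\<close> exceeded \<open>c\<close> throughout \<open>A\<close>, the
  hypothesis would leave nothing for the integral of the excess \<open>f - c\<close>. The excess
  would then vanish almost everywhere on \<open>A\<close>, although it is positive there and
  \<open>A\<close> is not null.\<close>

lemma nn_integral_exists_le_average:
  assumes [measurable]: "f \<in> borel_measurable M" "A \<in> sets M"
    and "emeasure M A \<noteq> 0" "emeasure M A \<noteq> \<infinity>"
    and le: "(\<integral>\<^sup>+ x\<in>A. f x \<partial>M) \<le> c * emeasure M A"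
  shows "\<exists>x\<in>A. f x \<le> c"
proof (rule ccontr)
  assume "\<not> ?thesis"
  then have gt: "c < f x" if "x \<in> A" for x using that by auto
  moreover have "A \<noteq> {}" using assms(3) by auto
  \<comment> \<open>Finiteness of \<open>c\<close>, and hence of \<open>c * emeasure M A\<close>, is
    what makes the later cancellation in \<open>ennreal\<close> legitimate.\<close>
  ultimately have c: "c \<noteq> \<infinity>" by fastforce
  have "(\<integral>\<^sup>+ x\<in>A. f x \<partial>M) = (\<integral>\<^sup>+ x. c * indicator A x + (f x - c) * indicator A x \<partial>M)"
    using gt by (intro nn_integral_cong) (auto simp: indicator_def less_imp_le intro!: ennreal_ineq_diff_add)
  also have "\<dots> = c * emeasure M A + (\<integral>\<^sup>+ x\<in>A. (f x - c) \<partial>M)"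
    by (subst nn_integral_add) (auto simp: nn_integral_cmult_indicator)
  finally have "c * emeasure M A + (\<integral>\<^sup>+ x\<in>A. (f x - c) \<partial>M) \<le> c * emeasure M A + 0"
    using le by simp
  moreover have "c * emeasure M A \<noteq> \<infinity>"
    using c assms(4) by (simp add: ennreal_mult_eq_top_iff)
  ultimately have "(\<integral>\<^sup>+ x\<in>A. (f x - c) \<partial>M) = 0"
    by (metis add.right_neutral ennreal_add_left_cancel_le infinity_ennreal_def le_zero_eq)
  then have "AE x in M. (f x - c) * indicator A x = 0"
    by (subst (asm) nn_integral_0_iff_AE) auto
  then have "AE x in M. x \<notin> A"
  proof eventually_elim
    case (elim x)
    show ?case
    proof
      assume "x \<in> A"
      with elim have "f x - c = 0" by simp
      with gt[OF \<open>x \<in> A\<close>] show False by (metis diff_gr0_ennreal less_irrefl)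
    qed
  qed
  then have "emeasure M A = 0"
    by (subst (asm) AE_iff_measurable[of A]) (use sets.sets_into_space[OF assms(2)] in auto)
  with assms(3) show False by simp
qed

subsection \<open>Interior balls of uniform domains\<close>

lemma dist_le_curve_length:
  assumes "a \<le> b"
  shows "ereal (dist (g a) (g b)) \<le> curve_length g a b"
  unfolding curve_length_def
  by (rule SUP_upper2[of "[a, b]"]) (use assms in auto)

text \<open>An arc in \<open>D\<close> from \<open>x\<close> to a far point passes through a point
  at distance exactly \<tau> from \<open>x\<close>. Both subarcs at that point have length at least
  \<tau>, so the condition on the shorter subarc keeps the point at distance at least
  \<open>\<tau> / c\<close> from the frontier; the ball is centred there.\<close>

lemma uniform_domain_corkscrew:
  fixes D :: "'a::euclidean_space set"
  assumes "uniform_domain D c"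
  obtains \<delta> where "0 < \<delta>"
    "\<And>x \<tau>. \<lbrakk>x \<in> D; 0 < \<tau>; \<tau> \<le> \<delta>\<rbrakk> \<Longrightarrow> \<exists>a. ball a (\<tau> / c) \<subseteq> D \<inter> cball x (2 * \<tau>)"
proof -
  have D: "open D" "D \<noteq> {}" "c \<ge> 1" using assms by (auto simp: uniform_domain_def)
  obtain p where p: "p \<in> D" using D by auto
  then obtain q where q: "q \<in> D" "q \<noteq> p"
  proof -
    have "p islimpt D" using interior_limit_point[of p D] D p by (simp add: interior_open)
    then show ?thesis using that D(1) p by (auto simp: islimpt_def dest: spec[of _ D])
  qed
  \<comment> \<open>With a quarter of \<open>dist p q\<close>, every \<open>x\<close> has distance
    at least \<open>2 * \<delta>\<close> from \<open>p\<close> or from \<open>q\<close>. An arc to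
    that point still has length at least \<tau> left after reaching distance \<tau> from
    \<open>x\<close>.\<close>
  define \<delta> where "\<delta> = dist p q / 4"
  have "0 < \<delta>" using q by (simp add: \<delta>_def)
  moreover have "\<exists>a. ball a (\<tau> / c) \<subseteq> D \<inter> cball x (2 * \<tau>)"
    if x: "x \<in> D" and \<tau>: "0 < \<tau>" "\<tau> \<le> \<delta>" for x \<tau>
  proof -
    obtain z where z: "z \<in> D" "dist x z \<ge> 2 * \<delta>"
    proof -
      have "dist p q \<le> dist x p + dist x q" by (rule dist_triangle3)
      then have "dist x p \<ge> 2 * \<delta> \<or> dist x q \<ge> 2 * \<delta>" by (auto simp: \<delta>_def)
      with that p q show ?thesis by auto
    qed
    then have "x \<noteq> z" using \<open>0 < \<delta>\<close> by auto
    with assms x z obtain g where g: "arc g" "pathstart g = x" "pathfinish g = z"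
        "path_image g \<subseteq> D"
      and len: "\<forall>t\<in>{0..1}. min (curve_length g 0 t) (curve_length g t 1)
                           \<le> ereal (c * infdist (g t) (frontier D))"
      unfolding uniform_domain_def by blast
    have "continuous_on {0..1} g" using g(1) by (simp add: arc_def path_def)
    then have cont: "continuous_on {0..1} (\<lambda>t. dist x (g t))" by (intro continuous_intros)
    have g0: "g 0 = x" and g1: "g 1 = z" using g by (auto simp: pathstart_def pathfinish_def)
    obtain t where t: "0 \<le> t" "t \<le> 1" "dist x (g t) = \<tau>"
      using IVT'[of "\<lambda>t. dist x (g t)" 0 \<tau> 1] cont g0 g1 \<tau> z by auto
    have "dist x z \<le> dist x (g t) + dist (g t) z" by (rule dist_triangle)
    then have "\<tau> \<le> dist (g t) (g 1)" using t(3) z \<tau> g1 by simp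
    then have "ereal \<tau> \<le> curve_length g t 1"
      using dist_le_curve_length[OF t(2), of g] by (metis ereal_less_eq(3) order_trans)
    moreover have "ereal \<tau> \<le> curve_length g 0 t"
      using dist_le_curve_length[OF t(1), of g] t(3) g0 by simp
    ultimately have "ereal \<tau> \<le> ereal (c * infdist (g t) (frontier D))"
      using len t by (meson atLeastAtMost_iff min.boundedI order_trans)
    then have inf: "\<tau> / c \<le> infdist (g t) (frontier D)"
      using D(3) by (simp add: field_simps)
    have "g t \<in> D" using g(4) t by (auto simp: path_image_def)
    \<comment> \<open>The ball is connected and its centre lies in \<open>D\<close>, so leaving
      \<open>D\<close> would force it to meet the frontier.\<close>
    have "ball (g t) (\<tau> / c) \<subseteq> D"
    proof (rule ccontr)
      assume "\<not> ?thesis"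
      moreover have "g t \<in> ball (g t) (\<tau> / c)" using \<tau> D(3) by simp
      ultimately have "ball (g t) (\<tau> / c) \<inter> frontier D \<noteq> {}"
        using \<open>g t \<in> D\<close> by (intro connected_Int_frontier connected_ball) blast+
      then obtain y where "dist (g t) y < \<tau> / c" "y \<in> frontier D" by auto
      with inf infdist_le[of y "frontier D" "g t"] show False by simp
    qed
    moreover have "ball (g t) (\<tau> / c) \<subseteq> cball x (2 * \<tau>)"
    proof
      fix y assume "y \<in> ball (g t) (\<tau> / c)"
      moreover have "\<tau> / c \<le> \<tau>" using \<tau> D(3) by (simp add: field_simps)
      moreover have "dist x y \<le> dist x (g t) + dist (g t) y" by (rule dist_triangle)
      ultimately show "y \<in> cball x (2 * \<tau>)" using t(3) by auto
    qed
    ultimately show ?thesis by blast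
  qed
  ultimately show thesis using that by blast
qed

subsection \<open>Kernel and directional integrals\<close>

text \<open>Split the tail into the dyadic shells
  \<open>2 ^ k * q \<le> dist x y < 2 ^ Suc k * q\<close>. The integrand on a shell is at most its
  value at the inner radius, the shell lies in the outer ball, and the resulting bounds form a
  geometric series with ratio \<open>2 powr (n - \<alpha>) < 1\<close>.\<close>

lemma nn_integral_dist_powr_tail:
  fixes \<alpha> :: real
  assumes "\<alpha> > DIM('a::euclidean_space)"
  obtains K :: real where "0 < K"
    "\<And>(x::'a) q. 0 < q \<Longrightarrow>
      (\<integral>\<^sup>+ y\<in>{y. q \<le> dist x y}. ennreal (dist x y powr (- \<alpha>)) \<partial>lborel)
        \<le> ennreal (K * q powr (real DIM('a) - \<alpha>))"
proof -
  define n where "n = DIM('a)"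
  define V where "V = unit_ball_vol (real n)"
  define \<theta> where "\<theta> = (2::real) powr (real n - \<alpha>)"
  have V: "0 < V" by (simp add: V_def)
  have \<theta>: "0 < \<theta>" "\<theta> < 1"
    using assms by (auto simp: \<theta>_def n_def intro!: powr_less_one)
  define K where "K = V * 2 ^ n * (1 / (1 - \<theta>))"
  have "(\<integral>\<^sup>+ y\<in>{y. q \<le> dist x y}. ennreal (dist x y powr (- \<alpha>)) \<partial>lborel)
        \<le> ennreal (K * q powr (real n - \<alpha>))" if q: "0 < q" for x :: 'a and q
  proof -
    define b where "b k = ennreal ((2 ^ k * q) powr (- \<alpha>))" for k :: nat
    have "(\<integral>\<^sup>+ y\<in>{y. q \<le> dist x y}. ennreal (dist x y powr (- \<alpha>)) \<partial>lborel)
        \<le> (\<integral>\<^sup>+ y. (\<Sum>k. b k * indicator (ball x (2 ^ Suc k * q)) y) \<partial>lborel)"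
    proof (rule nn_integral_mono)
      fix y
      show "ennreal (dist x y powr (- \<alpha>)) * indicator {y. q \<le> dist x y} y
        \<le> (\<Sum>k. b k * indicator (ball x (2 ^ Suc k * q)) y)"
      proof (cases "q \<le> dist x y")
        case True
        obtain m where m: "dist x y / q < 2 ^ m"
          using real_arch_pow[of 2 "dist x y / q"] by auto
        \<comment> \<open>Leastness of \<open>k\<close> gives the lower bound for the shell. Since
          \<open>q \<le> dist x y\<close> excludes \<open>k = 0\<close>, the shell has index
          \<open>k - 1\<close>.\<close>
        define k where "k = (LEAST m. dist x y / q < 2 ^ m)"
        have k: "dist x y / q < 2 ^ k" unfolding k_def using m by (rule LeastI)
        have "k \<noteq> 0" using k True q by (cases k) (auto simp: field_simps)
        then obtain j where j: "k = Suc j" by (cases k) auto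
        have "\<not> dist x y / q < 2 ^ j"
          using not_less_Least[of j "\<lambda>m. dist x y / q < 2 ^ m"] j k_def by simp
        then have lo: "2 ^ j * q \<le> dist x y" using q by (simp add: field_simps)
        have hi: "dist x y < 2 ^ Suc j * q" using k j q by (simp add: field_simps)
        have "ennreal (dist x y powr (- \<alpha>)) \<le> b j"
          unfolding b_def using lo q assms by (intro ennreal_leI powr_mono2') auto
        also have "\<dots> = (\<Sum>k\<in>{j}. b k * indicator (ball x (2 ^ Suc k * q)) y)"
          using hi by (simp del: power_Suc)
        also have "\<dots> \<le> (\<Sum>k. b k * indicator (ball x (2 ^ Suc k * q)) y)"
          by (rule sum_le_suminf) auto
        finally show ?thesis by (simp add: indicator_def)
      qed simp
    qed
    also have "\<dots> = (\<Sum>k. b k * emeasure lborel (ball x (2 ^ Suc k * q)))"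
      by (simp add: nn_integral_suminf nn_integral_cmult_indicator del: power_Suc)
    also have "\<dots> = (\<Sum>k. ennreal (V * 2 ^ n * q powr (real n - \<alpha>) * \<theta> ^ k))"
    proof (rule suminf_cong)
      fix k :: nat
      have "(2 ^ k * q) powr (- \<alpha>) * (V * (2 ^ Suc k * q) ^ n)
          = V * 2 ^ n * ((2 ^ k * q) powr (- \<alpha>) * (2 ^ k * q) powr real n)"
        using q by (simp add: powr_realpow power_mult_distrib)
      also have "\<dots> = V * 2 ^ n * (2 ^ k * q) powr (real n - \<alpha>)"
        by (simp add: powr_add[symmetric])
      also have "\<dots> = V * 2 ^ n * q powr (real n - \<alpha>) * \<theta> ^ k"
        using q by (simp add: powr_mult \<theta>_def powr_power powr_realpow[symmetric] powr_powr mult_ac)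
      finally have eq: "(2 ^ k * q) powr (- \<alpha>) * (V * (2 ^ Suc k * q) ^ n)
          = V * 2 ^ n * q powr (real n - \<alpha>) * \<theta> ^ k" .
      show "b k * emeasure lborel (ball x (2 ^ Suc k * q))
          = ennreal (V * 2 ^ n * q powr (real n - \<alpha>) * \<theta> ^ k)"
        unfolding eq[symmetric] using q V
        by (simp add: b_def emeasure_ball ennreal_mult[symmetric] n_def[symmetric] V_def[symmetric]
            del: power_Suc)
    qed
    also have "\<dots> = ennreal (V * 2 ^ n * q powr (real n - \<alpha>) * (1 / (1 - \<theta>)))"
      using V \<theta> by (intro suminf_ennreal_eq sums_mult geometric_sums) auto
    finally show ?thesis by (simp add: K_def mult_ac)
  qed
  moreover have "0 < K" using V \<theta> by (simp add: K_def)
  ultimately show thesis using that by (auto simp: n_def)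
qed

text \<open>The function \<open>\<xi> \<bullet> (x - w)\<close> changes by
  \<open>\<rho> * norm \<xi> / 2\<close> when \<open>w\<close> moves by \<open>\<rho> / 2\<close>
  along \<xi>, so at one of the two positions its modulus is at least
  \<open>\<rho> * norm \<xi> / 4\<close>. Integrating over the ball of half the radius keeps both
  positions inside the full ball; the two resulting integrals account for the factor 2.\<close>

lemma ball_average_inner_powr:
  fixes a x \<xi> :: "'a::euclidean_space"
  assumes "0 < \<rho>" "0 < p"
  shows "ennreal ((\<rho> * norm \<xi> / 4) powr p * (unit_ball_vol DIM('a) * (\<rho> / 2) ^ DIM('a)))
    \<le> 2 * (\<integral>\<^sup>+ w\<in>ball a \<rho>. ennreal (\<bar>\<xi> \<bullet> (x - w)\<bar> powr p) \<partial>lborel)"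
proof -
  \<comment> \<open>For \<open>\<xi> = 0\<close> the value of \<open>sgn \<xi>\<close> is 0, and
    both facts about \<open>h\<close> remain true.\<close>
  define h where "h = (\<rho> / 2) *\<^sub>R sgn \<xi>"
  have h: "norm h \<le> \<rho> / 2" "\<xi> \<bullet> h = \<rho> * norm \<xi> / 2"
    using assms
    by (cases "\<xi> = 0"; simp add: h_def norm_sgn sgn_div_norm power2_norm_eq_inner[symmetric] power2_eq_square)+
  let ?f = "\<lambda>w. ennreal (\<bar>\<xi> \<bullet> (x - w)\<bar> powr p)"
  let ?B = "ball a (\<rho> / 2)"
  have pt: "ennreal ((\<rho> * norm \<xi> / 4) powr p) \<le> ?f w + ?f (w + h)" for w
  proof -
    have "\<xi> \<bullet> (x - w) - \<xi> \<bullet> (x - (w + h)) = \<xi> \<bullet> h" by (simp add: inner_diff_right inner_add_right)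
    then have "\<rho> * norm \<xi> / 4 \<le> \<bar>\<xi> \<bullet> (x - w)\<bar> \<or> \<rho> * norm \<xi> / 4 \<le> \<bar>\<xi> \<bullet> (x - (w + h))\<bar>"
      using h(2) by linarith
    then show ?thesis
      using assms
      by (elim disjE; intro order_trans[OF _ add_increasing2[OF zero_le order_refl]]
          order_trans[OF _ add_increasing[OF zero_le order_refl]] ennreal_leI powr_mono2) auto
  qed
  have "ennreal ((\<rho> * norm \<xi> / 4) powr p * (unit_ball_vol DIM('a) * (\<rho> / 2) ^ DIM('a)))
      = (\<integral>\<^sup>+ w\<in>?B. ennreal ((\<rho> * norm \<xi> / 4) powr p) \<partial>lborel)"
    using assms by (simp add: nn_integral_cmult_indicator emeasure_ball ennreal_mult)
  also have "\<dots> \<le> (\<integral>\<^sup>+ w. ?f w * indicator ?B w + ?f (w + h) * indicator ?B w \<partial>lborel)"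
    using pt by (intro nn_integral_mono) (auto simp: indicator_def)
  also have "\<dots> = (\<integral>\<^sup>+ w\<in>?B. ?f w \<partial>lborel) + (\<integral>\<^sup>+ w\<in>?B. ?f (w + h) \<partial>lborel)"
    by (rule nn_integral_add) measurable
  also have "\<dots> \<le> (\<integral>\<^sup>+ w\<in>ball a \<rho>. ?f w \<partial>lborel) + (\<integral>\<^sup>+ w\<in>ball a \<rho>. ?f w \<partial>lborel)"
  proof (intro add_mono)
    show "(\<integral>\<^sup>+ w\<in>?B. ?f w \<partial>lborel) \<le> (\<integral>\<^sup>+ w\<in>ball a \<rho>. ?f w \<partial>lborel)"
      using assms by (intro nn_integral_mono) (auto simp: indicator_def)
    show "(\<integral>\<^sup>+ w\<in>?B. ?f (w + h) \<partial>lborel) \<le> (\<integral>\<^sup>+ w\<in>ball a \<rho>. ?f w \<partial>lborel)"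
    proof (rule nn_integral_translate_subset)
      fix w assume "w \<in> ?B"
      then have "dist a w < \<rho> / 2" by simp
      then show "w + h \<in> ball a \<rho>"
        using h(1) norm_triangle_ineq4[of "a - w" h] by (simp add: dist_norm algebra_simps)
    qed auto
  qed
  finally show ?thesis by (simp add: mult_2)
qed

subsection \<open>Strain and the absorption estimate\<close>

text \<open>A nonlocal counterpart of linear strain: for smooth \<open>u\<close> it is, to leading
  order, the quadratic form of the symmetric gradient evaluated at \<open>x - y\<close>.\<close>

definition strain :: "('a::real_inner \<Rightarrow> 'a) \<Rightarrow> 'a \<Rightarrow> 'a \<Rightarrow> real" where
  "strain u x y = (u x - u y) \<bullet> (x - y)"

text \<open>This and \<open>strain_energy\<close> are the double integrals inside the two seminorms.
  They stay in \<open>ennreal\<close>, so that infinite values remain visible, and use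
  \<open>lborel\<close>, so that Tonelli's theorem applies to Borel fields.\<close>

definition gagliardo_energy ::
    "real \<Rightarrow> real \<Rightarrow> 'a::euclidean_space set \<Rightarrow> ('a \<Rightarrow> 'a) \<Rightarrow> ennreal" where
  "gagliardo_energy s p \<Omega> u = (\<integral>\<^sup>+ x\<in>\<Omega>. (\<integral>\<^sup>+ y\<in>\<Omega>.
     ennreal (norm (u x - u y) powr p / dist x y powr (real DIM('a) + s * p)) \<partial>lborel) \<partial>lborel)"

definition strain_energy ::
    "real \<Rightarrow> real \<Rightarrow> 'a::euclidean_space set \<Rightarrow> ('a \<Rightarrow> 'a) \<Rightarrow> ennreal" where
  "strain_energy s p \<Omega> u = (\<integral>\<^sup>+ x\<in>\<Omega>. (\<integral>\<^sup>+ y\<in>\<Omega>.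
     ennreal (\<bar>strain u x y\<bar> powr p / dist x y powr (real DIM('a) + s * p + p)) \<partial>lborel) \<partial>lborel)"

lemma strain_measurable [measurable]:
  fixes u :: "'a::euclidean_space \<Rightarrow> 'a"
  assumes [measurable]: "u \<in> borel_measurable borel" "f \<in> borel_measurable M" "g \<in> borel_measurable M"
  shows "(\<lambda>z. strain u (f z) (g z)) \<in> borel_measurable M"
  unfolding strain_def by measurable

lemma strain_commute: "strain u x y = strain u y x"
  by (simp add: strain_def inner_diff_left inner_diff_right)

lemma strain_three_point:
  "(v x - v y) \<bullet> (x - w) = (v w - v y) \<bullet> (x - y) + strain v x w - strain v y w"
  by (simp add: strain_def inner_diff_left inner_diff_right)

section \<open>Averaging over interior balls at every scale, and absorption\<close>

text \<open>Integrate in \<open>y\<close> first. For fixed \<open>x\<close> and \<open>w\<close> the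
  kernel lives on the tail \<open>q \<le> dist x y\<close> with
  \<open>q = dist x w / (3 * M)\<close>, and the tail estimate gives a multiple of
  \<open>q powr (- (n + \<beta>))\<close>. This produces both the power of \<open>M\<close> and the
  weight in \<open>dist x w\<close>.\<close>

lemma scale_kernel_integral_le:
  fixes \<beta> :: real
  assumes "0 < \<beta>"
  obtains K :: real where "0 < K"
    "\<And>(\<Omega>::'a::euclidean_space set) (H :: 'a \<Rightarrow> 'a \<Rightarrow> ennreal) M.
      \<lbrakk>0 < M; \<Omega> \<in> sets borel; case_prod H \<in> borel_measurable (borel \<Otimes>\<^sub>M borel); \<And>x. H x x = 0\<rbrakk> \<Longrightarrow>
      (\<integral>\<^sup>+ x\<in>\<Omega>. (\<integral>\<^sup>+ y\<in>\<Omega>. (\<integral>\<^sup>+ w\<in>\<Omega>.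
          ennreal (if dist x w \<le> 3 * M * dist x y
             then dist x y powr (- (2 * real DIM('a) + \<beta>)) else 0) * H x w
        \<partial>lborel) \<partial>lborel) \<partial>lborel)
      \<le> ennreal (K * M powr (real DIM('a) + \<beta>)) *
        (\<integral>\<^sup>+ x\<in>\<Omega>. (\<integral>\<^sup>+ w\<in>\<Omega>. H x w * ennreal (dist x w powr (- (real DIM('a) + \<beta>)))
        \<partial>lborel) \<partial>lborel)"
proof -
  define n where "n = real DIM('a)"
  have "2 * n + \<beta> > real DIM('a)" using assms by (simp add: n_def)
  then obtain K0 where K0: "0 < K0"
    "\<And>(x::'a) q. 0 < q \<Longrightarrow>
      (\<integral>\<^sup>+ y\<in>{y. q \<le> dist x y}. ennreal (dist x y powr (- (2 * n + \<beta>))) \<partial>lborel)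
        \<le> ennreal (K0 * q powr (n - (2 * n + \<beta>)))"
    unfolding n_def using nn_integral_dist_powr_tail[where 'a='a] by blast
  define K where "K = K0 * 3 powr (n + \<beta>)"
  have "0 < K" using K0 by (simp add: K_def)
  moreover have "(\<integral>\<^sup>+ x\<in>\<Omega>. (\<integral>\<^sup>+ y\<in>\<Omega>. (\<integral>\<^sup>+ w\<in>\<Omega>.
          ennreal (if dist x w \<le> 3 * M * dist x y then dist x y powr (- (2 * n + \<beta>)) else 0) * H x w
        \<partial>lborel) \<partial>lborel) \<partial>lborel)
      \<le> ennreal (K * M powr (n + \<beta>)) *
        (\<integral>\<^sup>+ x\<in>\<Omega>. (\<integral>\<^sup>+ w\<in>\<Omega>. H x w * ennreal (dist x w powr (- (n + \<beta>)))
        \<partial>lborel) \<partial>lborel)"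
    if M: "0 < M" and [measurable]: "\<Omega> \<in> sets borel"
      "case_prod H \<in> borel_measurable (borel \<Otimes>\<^sub>M borel)" and H0: "\<And>x. H x x = 0"
    for \<Omega> :: "'a set" and H :: "'a \<Rightarrow> 'a \<Rightarrow> ennreal" and M
  proof -
    let ?k = "\<lambda>x y w :: 'a. ennreal (if dist x w \<le> 3 * M * dist x y then dist x y powr (- (2 * n + \<beta>)) else 0)"
    have int_k: "(\<integral>\<^sup>+ y\<in>\<Omega>. ?k x y w \<partial>lborel) * H x w
        \<le> ennreal (K * M powr (n + \<beta>)) * (H x w * ennreal (dist x w powr (- (n + \<beta>))))" for x w
    proof (cases "x = w")
      case False
      define q where "q = dist x w / (3 * M)"
      have q: "0 < q" using False M by (simp add: q_def)
      have "(\<integral>\<^sup>+ y\<in>\<Omega>. ?k x y w \<partial>lborel)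
          \<le> (\<integral>\<^sup>+ y\<in>{y. q \<le> dist x y}. ennreal (dist x y powr (- (2 * n + \<beta>))) \<partial>lborel)"
        using M by (intro nn_integral_mono) (auto simp: indicator_def q_def field_simps)
      also have "\<dots> \<le> ennreal (K0 * q powr (n - (2 * n + \<beta>)))" by (rule K0(2)[OF q])
      also have "K0 * q powr (n - (2 * n + \<beta>)) = K * M powr (n + \<beta>) * dist x w powr (- (n + \<beta>))"
        using M False
        by (simp add: q_def K_def powr_divide powr_mult powr_minus field_simps powr_add powr_diff)
      finally have "(\<integral>\<^sup>+ y\<in>\<Omega>. ?k x y w \<partial>lborel) * H x w
          \<le> ennreal (K * M powr (n + \<beta>) * dist x w powr (- (n + \<beta>))) * H x w"
        by (rule mult_right_mono) simp
      then show ?thesis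
        using \<open>0 < K\<close> by (simp add: ennreal_mult mult_ac)
    qed (simp add: H0)
    have "(\<integral>\<^sup>+ y\<in>\<Omega>. (\<integral>\<^sup>+ w\<in>\<Omega>. ?k x y w * H x w \<partial>lborel) \<partial>lborel)
        \<le> ennreal (K * M powr (n + \<beta>)) *
          (\<integral>\<^sup>+ w\<in>\<Omega>. H x w * ennreal (dist x w powr (- (n + \<beta>))) \<partial>lborel)" for x
    proof -
      have "(\<integral>\<^sup>+ y\<in>\<Omega>. (\<integral>\<^sup>+ w\<in>\<Omega>. ?k x y w * H x w \<partial>lborel) \<partial>lborel)
        = (\<integral>\<^sup>+ y. (\<integral>\<^sup>+ w. ?k x y w * indicator \<Omega> y * (H x w * indicator \<Omega> w) \<partial>lborel) \<partial>lborel)"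
        by (intro nn_integral_cong) (simp add: mult_ac split: split_indicator)
      also have "\<dots> = (\<integral>\<^sup>+ w. (\<integral>\<^sup>+ y. ?k x y w * indicator \<Omega> y * (H x w * indicator \<Omega> w) \<partial>lborel) \<partial>lborel)"
        by (rule lborel_pair.Fubini') measurable
      also have "\<dots> = (\<integral>\<^sup>+ w. (\<integral>\<^sup>+ y\<in>\<Omega>. ?k x y w \<partial>lborel) * (H x w * indicator \<Omega> w) \<partial>lborel)"
        by (intro nn_integral_cong nn_integral_multc) measurable
      also have "\<dots> \<le> (\<integral>\<^sup>+ w. ennreal (K * M powr (n + \<beta>)) *
          (H x w * ennreal (dist x w powr (- (n + \<beta>))) * indicator \<Omega> w) \<partial>lborel)"
        using int_k by (intro nn_integral_mono) (auto simp: indicator_def)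
      also have "\<dots> = ennreal (K * M powr (n + \<beta>)) *
          (\<integral>\<^sup>+ w\<in>\<Omega>. H x w * ennreal (dist x w powr (- (n + \<beta>))) \<partial>lborel)"
        by (rule nn_integral_cmult) measurable
      finally show ?thesis .
    qed
    then have "(\<integral>\<^sup>+ x\<in>\<Omega>. (\<integral>\<^sup>+ y\<in>\<Omega>. (\<integral>\<^sup>+ w\<in>\<Omega>. ?k x y w * H x w \<partial>lborel) \<partial>lborel) \<partial>lborel)
        \<le> (\<integral>\<^sup>+ x. ennreal (K * M powr (n + \<beta>)) *
          ((\<integral>\<^sup>+ w\<in>\<Omega>. H x w * ennreal (dist x w powr (- (n + \<beta>))) \<partial>lborel) * indicator \<Omega> x) \<partial>lborel)"
      by (intro nn_integral_mono) (auto simp: indicator_def)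
    also have "\<dots> = ennreal (K * M powr (n + \<beta>)) * (\<integral>\<^sup>+ x\<in>\<Omega>.
          (\<integral>\<^sup>+ w\<in>\<Omega>. H x w * ennreal (dist x w powr (- (n + \<beta>))) \<partial>lborel) \<partial>lborel)"
      by (rule nn_integral_cmult) measurable
    finally show ?thesis .
  qed
  ultimately show thesis using that unfolding n_def by blast
qed

text \<open>Dividing the three-point identity by the size \<open>M * dist x y\<close> of \<open>x - w\<close> makes the
  non-strain term carry the small factor \<open>1 / M\<close>; this is what permits the absorption below.\<close>

lemma difference_le_scale_average:
  fixes v :: "'a::euclidean_space \<Rightarrow> 'a" and \<kappa> p s M :: real
  defines "n \<equiv> real DIM('a)"
  defines "c \<equiv> (\<kappa> / 4) powr p * unit_ball_vol n * (\<kappa> / 2) powr n / 2"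
  assumes [measurable]: "v \<in> borel_measurable borel" "\<Omega> \<in> sets borel"
    and "x \<noteq> y" "0 < \<kappa>" "1 \<le> M" "0 < p"
    and ball: "ball a (\<kappa> * (M * dist x y)) \<subseteq> \<Omega> \<inter> cball x (2 * (M * dist x y))"
  defines "k \<equiv> \<lambda>x y w :: 'a. ennreal (if dist x w \<le> 3 * M * dist x y
      then dist x y powr (- (2 * n + s * p)) else 0)"
  defines "H \<equiv> \<lambda>x w :: 'a. ennreal (\<bar>strain v x w\<bar> powr p / dist x w powr p
      + M powr (- p) * norm (v x - v w) powr p)"
  shows "ennreal (norm (v x - v y) powr p / dist x y powr (n + s * p))
    \<le> ennreal (9 powr p / c * M powr (- n)) * (\<integral>\<^sup>+ w\<in>\<Omega>. (k x y w * H x w + k y x w * H y w) \<partial>lborel)"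
proof -
  define t where "t = dist x y"
  define \<tau> where "\<tau> = M * t"
  have t: "0 < t" "0 < \<tau>" "t \<le> \<tau>" using assms by (auto simp: t_def \<tau>_def)
  have c: "0 < c" using assms by (simp add: c_def)
  \<comment> \<open>\<open>Q\<close> normalises the averaged lower bound: multiplied by it, the
    bound becomes exactly the Gagliardo integrand at \<open>(x, y)\<close>.\<close>
  define Q where "Q = 1 / (c * \<tau> powr (n + p) * t powr (n + s * p))"
  have Q: "0 < Q" using c t by (simp add: Q_def)
  define \<xi> where "\<xi> = v x - v y"
  define T where "T = t powr (- (2 * n + s * p))"
  \<comment> \<open>Since \<open>\<tau> = M * t\<close>, the powers of \<tau> left over in
    \<open>Q * \<tau> powr p\<close> split into \<open>M powr (- n)\<close> and the kernel
    \<open>T\<close>.\<close>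
  have QT: "Q * \<tau> powr p = M powr (- n) / c * T"
  proof -
    have "T * (t powr n * t powr (n + s * p)) = 1"
      using t by (simp add: T_def powr_add[symmetric] algebra_simps)
    then show ?thesis
      using t assms(7) c
      by (simp add: Q_def \<tau>_def powr_add powr_minus powr_mult field_simps)
  qed
  \<comment> \<open>The division by 2 in \<open>c\<close> compensates for the factor 2 in
    \<open>ball_average_inner_powr\<close>.\<close>
  have vol: "(\<kappa> * \<tau> * norm \<xi> / 4) powr p * (unit_ball_vol n * (\<kappa> * \<tau> / 2) ^ DIM('a))
      = 2 * (c * \<tau> powr (n + p) * norm \<xi> powr p)"
    using t assms(6)
    by (simp add: c_def n_def powr_realpow[symmetric] powr_mult powr_divide powr_add field_simps)
  have "2 * ennreal (c * \<tau> powr (n + p) * norm \<xi> powr p)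
      \<le> 2 * (\<integral>\<^sup>+ w\<in>ball a (\<kappa> * \<tau>). ennreal (\<bar>\<xi> \<bullet> (x - w)\<bar> powr p) \<partial>lborel)"
    using ball_average_inner_powr[where \<rho>="\<kappa> * \<tau>" and p=p and \<xi>=\<xi> and a=a and x=x] t assms(6,8) c vol
    by (simp add: n_def ennreal_mult'[of 2, simplified])
  then have avg: "ennreal (c * \<tau> powr (n + p) * norm \<xi> powr p)
      \<le> (\<integral>\<^sup>+ w\<in>ball a (\<kappa> * \<tau>). ennreal (\<bar>\<xi> \<bullet> (x - w)\<bar> powr p) \<partial>lborel)"
    by (simp add: ennreal_mult_le_mult_iff)
  have "norm \<xi> powr p / t powr (n + s * p) = Q * (c * \<tau> powr (n + p) * norm \<xi> powr p)"
    using c t by (simp add: Q_def field_simps)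
  then have "ennreal (norm \<xi> powr p / t powr (n + s * p))
      = ennreal Q * ennreal (c * \<tau> powr (n + p) * norm \<xi> powr p)"
    using Q c by (simp add: ennreal_mult)
  also have "\<dots> \<le> ennreal Q * (\<integral>\<^sup>+ w\<in>ball a (\<kappa> * \<tau>). ennreal (\<bar>\<xi> \<bullet> (x - w)\<bar> powr p) \<partial>lborel)"
    using avg by (intro mult_left_mono) auto
  also have "\<dots> = (\<integral>\<^sup>+ w. ennreal Q * (ennreal (\<bar>\<xi> \<bullet> (x - w)\<bar> powr p) * indicator (ball a (\<kappa> * \<tau>)) w) \<partial>lborel)"
    by (rule nn_integral_cmult[symmetric]) measurable
  also have "\<dots> \<le> (\<integral>\<^sup>+ w. ennreal (9 powr p / c * M powr (- n)) *
      ((k x y w * H x w + k y x w * H y w) * indicator \<Omega> w) \<partial>lborel)"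
  proof (rule nn_integral_mono)
    fix w
    show "ennreal Q * (ennreal (\<bar>\<xi> \<bullet> (x - w)\<bar> powr p) * indicator (ball a (\<kappa> * \<tau>)) w)
      \<le> ennreal (9 powr p / c * M powr (- n)) *
      ((k x y w * H x w + k y x w * H y w) * indicator \<Omega> w)"
    proof (cases "w \<in> ball a (\<kappa> * \<tau>)")
      case True
      then have w: "w \<in> \<Omega>" "dist x w \<le> 2 * \<tau>" using ball by (auto simp: \<tau>_def t_def)
      then have dx: "dist x w \<le> 3 * \<tau>" using t by simp
      \<comment> \<open>Moving the base point from \<open>x\<close> to \<open>y\<close> adds
        \<open>t \<le> \<tau>\<close> to the distance. The cutoff \<open>3 * M\<close> in
        \<open>k\<close> thus covers both base points.\<close>
      have dy: "dist y w \<le> 3 * \<tau>"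
        using w(2) t dist_triangle3[of y w x] by (simp add: t_def)
      \<comment> \<open>Trades the bare strain for the strain divided by the distance, which is the
        form in \<open>H\<close>; the price is the largest admissible distance
        \<open>3 * \<tau>\<close>. For \<open>z = w\<close> both sides are 0.\<close>
      have st: "\<bar>strain v z w\<bar> powr p \<le> (3 * \<tau>) powr p * (\<bar>strain v z w\<bar> powr p / dist z w powr p)"
        if "dist z w \<le> 3 * \<tau>" for z
      proof (cases "z = w")
        case False
        then have "dist z w powr p \<le> (3 * \<tau>) powr p"
          using that assms(8) by (intro powr_mono2) auto
        then have "\<bar>strain v z w\<bar> powr p * dist z w powr p \<le> \<bar>strain v z w\<bar> powr p * (3 * \<tau>) powr p"
          by (intro mult_left_mono) auto
        then show ?thesis using False by (simp add: field_simps)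
      qed (simp add: strain_def)
      let ?ex = "\<bar>strain v x w\<bar> powr p / dist x w powr p"
      let ?ey = "\<bar>strain v y w\<bar> powr p / dist y w powr p"
      let ?hx = "?ex + M powr (- p) * norm (v x - v w) powr p"
      let ?hy = "?ey + M powr (- p) * norm (v y - v w) powr p"
      have "\<bar>(v w - v y) \<bullet> (x - y)\<bar> \<le> norm (v y - v w) * t"
        using Cauchy_Schwarz_ineq2[of "v w - v y" "x - y"]
        by (simp add: t_def dist_norm norm_minus_commute)
      then have "\<bar>\<xi> \<bullet> (x - w)\<bar> \<le> norm (v y - v w) * t + \<bar>strain v x w\<bar> + \<bar>strain v y w\<bar>"
        unfolding \<xi>_def strain_three_point by linarith
      then have "\<bar>\<xi> \<bullet> (x - w)\<bar> powr p
          \<le> (norm (v y - v w) * t + \<bar>strain v x w\<bar> + \<bar>strain v y w\<bar>) powr p"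
        using assms(8) by (intro powr_mono2) auto
      also have "\<dots> \<le> 3 powr p *
          ((norm (v y - v w) * t) powr p + \<bar>strain v x w\<bar> powr p + \<bar>strain v y w\<bar> powr p)"
        using t assms(8) by (intro powr_add3_le) auto
      also have "\<dots> \<le> 3 powr p *
          ((3 * \<tau>) powr p * (M powr (- p) * norm (v y - v w) powr p) + (3 * \<tau>) powr p * ?ex + (3 * \<tau>) powr p * ?ey)"
      proof (intro mult_left_mono add_mono st dx dy)
        \<comment> \<open>Writing \<open>t\<close> as \<open>\<tau> / M\<close> brings out the small
          weight \<open>M powr (- p)\<close> on the only term that is not a strain.\<close>
        have "(norm (v y - v w) * t) powr p = \<tau> powr p * (M powr (- p) * norm (v y - v w) powr p)"
          using t assms(7) by (simp add: \<tau>_def powr_mult powr_minus)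
        also have "\<dots> \<le> (3 * \<tau>) powr p * (M powr (- p) * norm (v y - v w) powr p)"
          using t assms(8) by (intro mult_right_mono powr_mono2) auto
        finally show "(norm (v y - v w) * t) powr p \<le> (3 * \<tau>) powr p * (M powr (- p) * norm (v y - v w) powr p)" .
      qed auto
      also have "\<dots> = 9 powr p * \<tau> powr p * (?ex + ?hy)"
        using t powr_mult[of 3 3 p] by (simp add: powr_mult algebra_simps)
      \<comment> \<open>Adding the nonnegative term in \<open>v x - v w\<close> makes the bound
        symmetric in \<open>x\<close> and \<open>y\<close>, so that one function \<open>H\<close>
        serves both base points.\<close>
      also have "\<dots> \<le> 9 powr p * \<tau> powr p * (?hx + ?hy)"
        by (intro mult_left_mono) auto
      finally have "Q * \<bar>\<xi> \<bullet> (x - w)\<bar> powr p \<le> Q * (9 powr p * \<tau> powr p * (?hx + ?hy))"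
        using Q by (intro mult_left_mono) auto
      also have "\<dots> = 9 powr p * (Q * \<tau> powr p) * (?hx + ?hy)" by (simp only: mult_ac)
      also have "\<dots> = 9 powr p / c * M powr (- n) * (T * ?hx + T * ?hy)"
        unfolding QT by (simp add: algebra_simps)
      finally have "ennreal (Q * \<bar>\<xi> \<bullet> (x - w)\<bar> powr p)
          \<le> ennreal (9 powr p / c * M powr (- n) * (T * ?hx + T * ?hy))"
        by (rule ennreal_leI)
      also have "\<dots> = ennreal (9 powr p / c * M powr (- n)) * (k x y w * H x w + k y x w * H y w)"
      proof -
        have kT: "k x y w = ennreal T" "k y x w = ennreal T"
          using dx dy by (simp_all add: k_def T_def t_def \<tau>_def dist_commute mult.assoc)
        have HH: "H x w = ennreal ?hx" "H y w = ennreal ?hy" by (simp_all add: H_def)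
        have E: "ennreal (\<alpha> * (T * g + T * h)) = ennreal \<alpha> * (ennreal T * ennreal g + ennreal T * ennreal h)"
          if "0 \<le> \<alpha>" "0 \<le> g" "0 \<le> h" for \<alpha> g h
          using that by (simp add: T_def ennreal_mult ennreal_plus)
        show ?thesis unfolding kT HH by (rule E) (use c in auto)
      qed
      finally show ?thesis using True w(1) Q by (simp add: ennreal_mult)
    qed simp
  qed
  also have "\<dots> = ennreal (9 powr p / c * M powr (- n)) *
      (\<integral>\<^sup>+ w\<in>\<Omega>. (k x y w * H x w + k y x w * H y w) \<partial>lborel)"
    unfolding k_def H_def by (rule nn_integral_cmult) measurable
  finally show ?thesis by (simp add: \<xi>_def t_def)
qed

lemma nn_integral_pair_add:
  fixes f g :: "'a::euclidean_space \<Rightarrow> 'b::euclidean_space \<Rightarrow> ennreal"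
  assumes [measurable]: "A \<in> sets borel" "B \<in> sets borel"
    "case_prod f \<in> borel_measurable (borel \<Otimes>\<^sub>M borel)" "case_prod g \<in> borel_measurable (borel \<Otimes>\<^sub>M borel)"
  shows "(\<integral>\<^sup>+ x\<in>A. (\<integral>\<^sup>+ y\<in>B. (f x y + g x y) \<partial>lborel) \<partial>lborel)
    = (\<integral>\<^sup>+ x\<in>A. (\<integral>\<^sup>+ y\<in>B. f x y \<partial>lborel) \<partial>lborel) + (\<integral>\<^sup>+ x\<in>A. (\<integral>\<^sup>+ y\<in>B. g x y \<partial>lborel) \<partial>lborel)"
  by (simp add: distrib_right nn_integral_add)

lemma nn_integral_pair_cmult:
  fixes f :: "'a::euclidean_space \<Rightarrow> 'b::euclidean_space \<Rightarrow> ennreal"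
  assumes [measurable]: "A \<in> sets borel" "B \<in> sets borel"
    "case_prod f \<in> borel_measurable (borel \<Otimes>\<^sub>M borel)"
  shows "(\<integral>\<^sup>+ x\<in>A. (\<integral>\<^sup>+ y\<in>B. c * f x y \<partial>lborel) \<partial>lborel)
    = c * (\<integral>\<^sup>+ x\<in>A. (\<integral>\<^sup>+ y\<in>B. f x y \<partial>lborel) \<partial>lborel)"
  by (simp add: mult.assoc nn_integral_cmult)

text \<open>Pairs with \<open>M * dist x y \<le> \<delta>\<close> are handled by averaging over an
  interior ball, and for the remaining pairs the singular kernel is bounded. Integrating the
  averages, \<open>M powr (- n)\<close> from the average meets \<open>M powr (n + s * p)\<close>
  from the kernel, which leaves \<open>M powr (s * p)\<close>; the non-strain part has the further
  factor \<open>M powr (- p)\<close>.\<close>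

lemma gagliardo_energy_scale_bound:
  fixes \<Omega> :: "'a::euclidean_space set" and \<kappa> \<delta> p s :: real
  assumes "open \<Omega>" and "0 < \<kappa>" "0 < \<delta>" "0 < p" "0 < s"
    and corkscrew: "\<And>x \<tau>. \<lbrakk>x \<in> \<Omega>; 0 < \<tau>; \<tau> \<le> \<delta>\<rbrakk> \<Longrightarrow>
      \<exists>a. ball a (\<kappa> * \<tau>) \<subseteq> \<Omega> \<inter> cball x (2 * \<tau>)"
  obtains C :: real where "0 < C"
    "\<And>v M. \<lbrakk>v \<in> borel_measurable borel; 1 \<le> M\<rbrakk> \<Longrightarrow>
      gagliardo_energy s p \<Omega> v \<le> ennreal (C * M powr (s * p)) * strain_energy s p \<Omega> v
        + ennreal (C * M powr (s * p - p)) * gagliardo_energy s p \<Omega> v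
        + ennreal ((M / \<delta>) powr (real DIM('a) + s * p)) *
          (\<integral>\<^sup>+ x\<in>\<Omega>. (\<integral>\<^sup>+ y\<in>\<Omega>. ennreal (norm (v x - v y) powr p) \<partial>lborel) \<partial>lborel)"
proof -
  define n where "n = real DIM('a)"
  define c where "c = (\<kappa> / 4) powr p * unit_ball_vol n * (\<kappa> / 2) powr n / 2"
  have c: "0 < c" using assms by (simp add: c_def n_def)
  have [measurable]: "\<Omega> \<in> sets borel" using assms(1) by simp
  have "0 < s * p" using assms by simp
  from scale_kernel_integral_le[OF this, where 'a='a] obtain K where K: "0 < K"
    "\<And>(\<Omega>::'a set) (H :: 'a \<Rightarrow> 'a \<Rightarrow> ennreal) M.
      \<lbrakk>0 < M; \<Omega> \<in> sets borel; case_prod H \<in> borel_measurable (borel \<Otimes>\<^sub>M borel); \<And>x. H x x = 0\<rbrakk> \<Longrightarrow>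
      (\<integral>\<^sup>+ x\<in>\<Omega>. (\<integral>\<^sup>+ y\<in>\<Omega>. (\<integral>\<^sup>+ w\<in>\<Omega>.
          ennreal (if dist x w \<le> 3 * M * dist x y
             then dist x y powr (- (2 * n + s * p)) else 0) * H x w
        \<partial>lborel) \<partial>lborel) \<partial>lborel)
      \<le> ennreal (K * M powr (n + s * p)) *
        (\<integral>\<^sup>+ x\<in>\<Omega>. (\<integral>\<^sup>+ w\<in>\<Omega>. H x w * ennreal (dist x w powr (- (n + s * p)))
        \<partial>lborel) \<partial>lborel)"
    unfolding n_def by blast
  \<comment> \<open>The 2 counts the base points \<open>x\<close> and \<open>y\<close>, whose
    contributions have equal integrals; the other factors come from the average and from the kernel
    integral.\<close>
  define C where "C = 2 * (9 powr p / c) * K"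
  have "0 < C" using c K by (simp add: C_def)
  moreover have "gagliardo_energy s p \<Omega> v \<le> ennreal (C * M powr (s * p)) * strain_energy s p \<Omega> v
        + ennreal (C * M powr (s * p - p)) * gagliardo_energy s p \<Omega> v
        + ennreal ((M / \<delta>) powr (n + s * p)) *
          (\<integral>\<^sup>+ x\<in>\<Omega>. (\<integral>\<^sup>+ y\<in>\<Omega>. ennreal (norm (v x - v y) powr p) \<partial>lborel) \<partial>lborel)"
    if [measurable]: "v \<in> borel_measurable borel" and M: "1 \<le> M" for v :: "'a \<Rightarrow> 'a" and M
  proof -
    define k where "k = (\<lambda>x y w :: 'a. ennreal (if dist x w \<le> 3 * M * dist x y
        then dist x y powr (- (2 * n + s * p)) else 0))"
    define H where "H = (\<lambda>x w :: 'a. ennreal (\<bar>strain v x w\<bar> powr p / dist x w powr p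
        + M powr (- p) * norm (v x - v w) powr p))"
    have [measurable]: "(\<lambda>z. k (f z) (g z) (h z)) \<in> borel_measurable N"
      if [measurable]: "f \<in> borel_measurable N" "g \<in> borel_measurable N" "h \<in> borel_measurable N"
      for f g h and N :: "'z measure"
      unfolding k_def by measurable
    have [measurable]: "(\<lambda>z. H (f z) (g z)) \<in> borel_measurable N"
      if [measurable]: "f \<in> borel_measurable N" "g \<in> borel_measurable N" for f g and N :: "'z measure"
      unfolding H_def by measurable
    have H_meas: "case_prod H \<in> borel_measurable (borel \<Otimes>\<^sub>M borel)"
      unfolding H_def by measurable
    define a where "a = 9 powr p / c * M powr (- n)"
    define b where "b = (M / \<delta>) powr (n + s * p)"
    define A where "A x y = (\<integral>\<^sup>+ w\<in>\<Omega>. k x y w * H x w \<partial>lborel)" for x y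
    have A_meas [measurable]: "case_prod A \<in> borel_measurable (borel \<Otimes>\<^sub>M borel)"
      unfolding A_def by measurable
    have pt: "ennreal (norm (v x - v y) powr p / dist x y powr (n + s * p))
        \<le> ennreal a * (A x y + A y x) + ennreal b * ennreal (norm (v x - v y) powr p)"
      if "x \<in> \<Omega>" "y \<in> \<Omega>" for x y
    proof (cases "x = y")
      case neq: False
      show ?thesis
      proof (cases "M * dist x y \<le> \<delta>")
        case True
        then obtain z where "ball z (\<kappa> * (M * dist x y)) \<subseteq> \<Omega> \<inter> cball x (2 * (M * dist x y))"
          using corkscrew[OF \<open>x \<in> \<Omega>\<close>, of "M * dist x y"] M neq by auto
        then have "ennreal (norm (v x - v y) powr p / dist x y powr (n + s * p))
          \<le> ennreal a * (\<integral>\<^sup>+ w\<in>\<Omega>. (k x y w * H x w + k y x w * H y w) \<partial>lborel)"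
          unfolding a_def c_def k_def H_def n_def
          using neq assms M by (intro difference_le_scale_average) auto
        also have "(\<integral>\<^sup>+ w\<in>\<Omega>. (k x y w * H x w + k y x w * H y w) \<partial>lborel) = A x y + A y x"
          unfolding A_def distrib_right by (rule nn_integral_add) measurable
        finally show ?thesis by (rule order_trans) simp
      next
        case False
        \<comment> \<open>Here \<open>1 / dist x y < M / \<delta>\<close>, so the pair is charged to
          the unweighted integral of the differences.\<close>
        have "1 / dist x y powr (n + s * p) = (1 / dist x y) powr (n + s * p)"
          by (simp add: powr_divide)
        also have "\<dots> \<le> b"
          unfolding b_def using False M neq assms
          by (intro powr_mono2) (auto simp: field_simps n_def)
        finally have "(1 / dist x y powr (n + s * p)) * norm (v x - v y) powr p
            \<le> b * norm (v x - v y) powr p"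
          by (rule mult_right_mono) simp
        then have "ennreal (norm (v x - v y) powr p / dist x y powr (n + s * p))
            \<le> ennreal b * ennreal (norm (v x - v y) powr p)"
          by (simp add: b_def flip: ennreal_mult)
        then show ?thesis by (rule order_trans) simp
      qed
    qed simp
    have tripleA: "(\<integral>\<^sup>+ x\<in>\<Omega>. (\<integral>\<^sup>+ y\<in>\<Omega>. A x y \<partial>lborel) \<partial>lborel)
        \<le> ennreal (K * M powr (n + s * p)) *
          (strain_energy s p \<Omega> v + ennreal (M powr (- p)) * gagliardo_energy s p \<Omega> v)"
    proof -
      \<comment> \<open>The weight produced by the kernel integral turns the two summands of
        \<open>H\<close> into the densities of the two energies.\<close>
      have Hk: "H x w * ennreal (dist x w powr (- (n + s * p)))
        = ennreal (\<bar>strain v x w\<bar> powr p / dist x w powr (n + s * p + p))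
          + ennreal (M powr (- p)) * ennreal (norm (v x - v w) powr p / dist x w powr (n + s * p))" for x w
      proof -
        have "ennreal (a / d + m * b) * ennreal (1 / D) = ennreal (a / (D * d)) + ennreal m * ennreal (b / D)"
          if "0 \<le> a" "0 \<le> d" "0 \<le> m" "0 \<le> b" "0 \<le> D" for a b d m D :: real
        proof -
          have "(a / d + m * b) * (1 / D) = a / (D * d) + m * (b / D)"
            by (simp add: add_divide_distrib)
          then show ?thesis using that by (simp flip: ennreal_mult ennreal_plus)
        qed
        then show ?thesis
          unfolding H_def powr_minus_divide[of "dist x w" "n + s * p"] powr_add[of "dist x w" "n + s * p" p]
          by simp
      qed
      have "(\<integral>\<^sup>+ x\<in>\<Omega>. (\<integral>\<^sup>+ y\<in>\<Omega>. A x y \<partial>lborel) \<partial>lborel)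
        \<le> ennreal (K * M powr (n + s * p)) *
          (\<integral>\<^sup>+ x\<in>\<Omega>. (\<integral>\<^sup>+ w\<in>\<Omega>. H x w * ennreal (dist x w powr (- (n + s * p))) \<partial>lborel) \<partial>lborel)"
        unfolding A_def k_def
      proof (rule K(2)[OF _ _ H_meas])
        show "H x x = 0" for x using assms(4) by (simp add: H_def strain_def)
      qed (use M in auto)
      also have "(\<integral>\<^sup>+ x\<in>\<Omega>. (\<integral>\<^sup>+ w\<in>\<Omega>. H x w * ennreal (dist x w powr (- (n + s * p))) \<partial>lborel) \<partial>lborel)
        = strain_energy s p \<Omega> v + ennreal (M powr (- p)) * gagliardo_energy s p \<Omega> v"
        unfolding Hk strain_energy_def gagliardo_energy_def n_def[symmetric]
        by (subst nn_integral_pair_add, measurable, subst nn_integral_pair_cmult, measurable)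
      finally show ?thesis .
    qed
    have swap: "(\<integral>\<^sup>+ x\<in>\<Omega>. (\<integral>\<^sup>+ y\<in>\<Omega>. A y x \<partial>lborel) \<partial>lborel) = (\<integral>\<^sup>+ x\<in>\<Omega>. (\<integral>\<^sup>+ y\<in>\<Omega>. A x y \<partial>lborel) \<partial>lborel)"
    proof -
      have "(\<integral>\<^sup>+ x\<in>\<Omega>. (\<integral>\<^sup>+ y\<in>\<Omega>. A y x \<partial>lborel) \<partial>lborel)
          = (\<integral>\<^sup>+ x. (\<integral>\<^sup>+ y. A y x * indicator \<Omega> y * indicator \<Omega> x \<partial>lborel) \<partial>lborel)"
        by (intro nn_integral_cong) (simp split: split_indicator)
      also have "\<dots> = (\<integral>\<^sup>+ y. (\<integral>\<^sup>+ x. A y x * indicator \<Omega> y * indicator \<Omega> x \<partial>lborel) \<partial>lborel)"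
        by (rule lborel_pair.Fubini') measurable
      also have "\<dots> = (\<integral>\<^sup>+ x\<in>\<Omega>. (\<integral>\<^sup>+ y\<in>\<Omega>. A x y \<partial>lborel) \<partial>lborel)"
        by (intro nn_integral_cong) (simp split: split_indicator)
      finally show ?thesis .
    qed
    let ?I = "\<integral>\<^sup>+ x\<in>\<Omega>. (\<integral>\<^sup>+ y\<in>\<Omega>. ennreal (norm (v x - v y) powr p) \<partial>lborel) \<partial>lborel"
    let ?A = "\<integral>\<^sup>+ x\<in>\<Omega>. (\<integral>\<^sup>+ y\<in>\<Omega>. A x y \<partial>lborel) \<partial>lborel"
    have "gagliardo_energy s p \<Omega> v \<le> (\<integral>\<^sup>+ x\<in>\<Omega>. (\<integral>\<^sup>+ y\<in>\<Omega>.
        ennreal a * (A x y + A y x) + ennreal b * ennreal (norm (v x - v y) powr p) \<partial>lborel) \<partial>lborel)"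
      unfolding gagliardo_energy_def n_def[symmetric] using pt
      by (intro nn_integral_mono) (auto simp: indicator_def intro!: nn_integral_mono)
    also have "\<dots> = ennreal a * (?A + (\<integral>\<^sup>+ x\<in>\<Omega>. (\<integral>\<^sup>+ y\<in>\<Omega>. A y x \<partial>lborel) \<partial>lborel)) + ennreal b * ?I"
      by (subst nn_integral_pair_add, measurable, subst nn_integral_pair_cmult, measurable,
          subst nn_integral_pair_cmult, measurable, subst nn_integral_pair_add, measurable)
    also have "\<dots> = ennreal (2 * a) * ?A + ennreal b * ?I"
    proof -
      have "ennreal (2 * a) = 2 * ennreal a" using ennreal_mult'[of 2 a] by simp
      then show ?thesis unfolding swap mult_2[symmetric] by (simp only: mult.assoc mult.left_commute)
    qed
    also have "\<dots> \<le> ennreal (2 * a) * (ennreal (K * M powr (n + s * p)) *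
          (strain_energy s p \<Omega> v + ennreal (M powr (- p)) * gagliardo_energy s p \<Omega> v)) + ennreal b * ?I"
      by (rule add_right_mono, rule mult_left_mono, rule tripleA) simp
    also have "ennreal (2 * a) * (ennreal (K * M powr (n + s * p)) *
          (strain_energy s p \<Omega> v + ennreal (M powr (- p)) * gagliardo_energy s p \<Omega> v))
        = ennreal (C * M powr (s * p)) * strain_energy s p \<Omega> v
          + ennreal (C * M powr (s * p - p)) * gagliardo_energy s p \<Omega> v"
    proof -
      have 1: "2 * a * (K * M powr (n + s * p)) = C * M powr (s * p)"
        using M by (simp add: a_def C_def powr_add powr_minus field_simps)
      have 2: "C * M powr (s * p) * M powr (- p) = C * M powr (s * p - p)"
        using M by (simp add: powr_diff powr_minus field_simps)
      have E: "ennreal P * (ennreal Q * (S + ennreal R * G)) = ennreal (P * Q) * S + ennreal (P * Q * R) * G"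
        if "0 \<le> P" "0 \<le> Q" "0 \<le> R" for P Q R S G
        using that by (simp add: ennreal_mult distrib_left mult.assoc)
      have "0 \<le> 2 * a" "0 \<le> K * M powr (n + s * p)" "0 \<le> M powr (- p)"
        using c K by (auto simp: a_def)
      from E[OF this] show ?thesis unfolding 1 2 .
    qed
    finally show ?thesis by (simp add: b_def)
  qed
  ultimately show thesis using that unfolding n_def by blast
qed

text \<open>Because \<open>s < 1\<close>, the coefficient \<open>C * M powr (s * p - p)\<close>
  drops to at most \<open>1 / 2\<close> for large \<open>M\<close>. The Gagliardo energy on the
  right can then be subtracted, provided that it is finite.\<close>

lemma gagliardo_energy_le_strain_energy:
  fixes \<Omega> :: "'a::euclidean_space set" and \<kappa> \<delta> p s :: real
  assumes "open \<Omega>" and "0 < \<kappa>" "0 < \<delta>" "0 < p" "0 < s" "s < 1"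
    and corkscrew: "\<And>x \<tau>. \<lbrakk>x \<in> \<Omega>; 0 < \<tau>; \<tau> \<le> \<delta>\<rbrakk> \<Longrightarrow>
      \<exists>a. ball a (\<kappa> * \<tau>) \<subseteq> \<Omega> \<inter> cball x (2 * \<tau>)"
  shows "\<exists>C>0. \<forall>v\<in>borel_measurable borel. gagliardo_energy s p \<Omega> v < \<infinity> \<longrightarrow>
      gagliardo_energy s p \<Omega> v \<le> ennreal C * (strain_energy s p \<Omega> v
        + (\<integral>\<^sup>+ x\<in>\<Omega>. (\<integral>\<^sup>+ y\<in>\<Omega>. ennreal (norm (v x - v y) powr p) \<partial>lborel) \<partial>lborel))"
proof (rule gagliardo_energy_scale_bound[OF assms(1-5)])
  show "\<exists>a. ball a (\<kappa> * \<tau>) \<subseteq> \<Omega> \<inter> cball x (2 * \<tau>)" if "x \<in> \<Omega>" "0 < \<tau>" "\<tau> \<le> \<delta>" for x \<tau>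
    using that by (rule corkscrew)
next
  fix C assume C: "0 < C"
    "\<And>v M. \<lbrakk>v \<in> borel_measurable borel; 1 \<le> M\<rbrakk> \<Longrightarrow>
      gagliardo_energy s p \<Omega> v \<le> ennreal (C * M powr (s * p)) * strain_energy s p \<Omega> v
        + ennreal (C * M powr (s * p - p)) * gagliardo_energy s p \<Omega> v
        + ennreal ((M / \<delta>) powr (real DIM('a) + s * p)) *
          (\<integral>\<^sup>+ x\<in>\<Omega>. (\<integral>\<^sup>+ y\<in>\<Omega>. ennreal (norm (v x - v y) powr p) \<partial>lborel) \<partial>lborel)"
  \<comment> \<open>The second entry solves \<open>M powr (p - s * p) = 2 * C\<close>; the maximum
    with 1 meets the requirement \<open>1 \<le> M\<close> of the scale bound.\<close>
  define M where "M = max 1 ((2 * C) powr (1 / (p - s * p)))"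
  have sp: "0 < p - s * p" using assms by (simp add: algebra_simps)
  have "2 * C = ((2 * C) powr (1 / (p - s * p))) powr (p - s * p)"
    using sp C(1) assms(4,6) unfolding powr_powr by simp
  also have "\<dots> \<le> M powr (p - s * p)"
    using sp by (intro powr_mono2) (auto simp: M_def)
  finally have CM: "2 * C \<le> M powr (p - s * p)" .
  moreover have "0 < M powr (p - s * p)" using CM C(1) by linarith
  ultimately have "C * (1 / M powr (p - s * p)) \<le> 1 / 2" by (simp add: field_simps)
  moreover have "M powr (s * p - p) = 1 / M powr (p - s * p)"
    using powr_minus_divide[of M "p - s * p"] by simp
  ultimately have "C * M powr (s * p - p) \<le> 1 / 2" by (simp only:)
  define B where "B = max (C * M powr (s * p)) ((M / \<delta>) powr (real DIM('a) + s * p))"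
  have "0 < B" using C by (auto simp: B_def M_def less_max_iff_disj)
  moreover have "gagliardo_energy s p \<Omega> v \<le> ennreal (2 * B) * (strain_energy s p \<Omega> v
        + (\<integral>\<^sup>+ x\<in>\<Omega>. (\<integral>\<^sup>+ y\<in>\<Omega>. ennreal (norm (v x - v y) powr p) \<partial>lborel) \<partial>lborel))"
    (is "?G \<le> ennreal (2 * B) * (?S + ?I)")
    if v: "v \<in> borel_measurable borel" "gagliardo_energy s p \<Omega> v < \<infinity>" for v
  proof -
    have "?G \<le> ennreal (C * M powr (s * p)) * ?S + ennreal (C * M powr (s * p - p)) * ?G
        + ennreal ((M / \<delta>) powr (real DIM('a) + s * p)) * ?I"
      by (rule C(2)[OF v(1)]) (simp add: M_def)
    also have "\<dots> \<le> ennreal B * ?S + ennreal (1 / 2) * ?G + ennreal B * ?I"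
      using \<open>C * M powr (s * p - p) \<le> 1 / 2\<close>
      by (intro add_mono mult_right_mono ennreal_leI) (auto simp: B_def)
    finally have le: "?G \<le> ennreal (1 / 2) * ?G + ennreal B * (?S + ?I)"
      by (simp add: distrib_left add_ac)
    \<comment> \<open>Finiteness turns the energy into a real number, for which half of it can be
      moved to the left; this doubles \<open>B\<close>.\<close>
    obtain G where G: "0 \<le> G" "?G = ennreal G" using v(2) by (cases "?G") auto
    show ?thesis
    proof (cases "?S + ?I")
      case (real T)
      have "ennreal G \<le> ennreal (1 / 2 * G + B * T)"
      proof -
        have "ennreal (1 / 2 * G + B * T) = ennreal (1 / 2) * ennreal G + ennreal B * ennreal T"
          using G(1) real \<open>0 < B\<close> ennreal_plus[of "1 / 2 * G" "B * T"]
            ennreal_mult'[of "1 / 2" G] ennreal_mult'[of B T] by simp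
        then show ?thesis using le by (simp only: G(2) real)
      qed
      then have "G \<le> 2 * B * T"
        using G real \<open>0 < B\<close> by (subst (asm) ennreal_le_iff) auto
      then show ?thesis using real G \<open>0 < B\<close> by (simp flip: ennreal_mult)
    next
      case top
      show ?thesis unfolding top using \<open>0 < B\<close> by (simp add: ennreal_mult_top)
    qed
  qed
  ultimately show ?thesis by (intro exI[of _ "2 * B"]) auto
qed

subsection \<open>Approximation by rigid motions\<close>

lemma matrix_vector_mult_measurable [measurable]:
  fixes A :: "real^'n^'m"
  shows "(\<lambda>x. A *v x) \<in> borel_measurable borel"
  by (intro borel_measurable_continuous_onI linear_continuous_on matrix_vector_mul_bounded_linear)

text \<open>In \<open>strain u x y - strain u x (y + \<rho> * e_i)\<close> the term
  \<open>u x \<bullet> x\<close> cancels, leaving \<rho> times the \<open>i\<close>-th component of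
  \<open>u x\<close> minus an affine function of \<open>x\<close>. Hence \<open>u\<close> minus an
  affine map is controlled by the strains against \<open>y\<close> and its shifts, and averaging
  over \<open>y\<close> finds a base point at which all of these are controlled by the double
  integral.\<close>

lemma affine_approximation:
  fixes \<Omega> :: "(real^'n) set" and p \<rho> :: real
  assumes "open \<Omega>" "ball a (3 * \<rho>) \<subseteq> \<Omega>" "0 < \<rho>" "0 < p"
  obtains C :: real where "0 < C"
    "\<And>u :: real^'n \<Rightarrow> real^'n. u \<in> borel_measurable borel \<Longrightarrow> \<exists>(L::real^'n^'n) b.
      (\<integral>\<^sup>+ x\<in>\<Omega>. ennreal (norm (u x - (L *v x + b)) powr p) \<partial>lborel)
      \<le> ennreal C * (\<integral>\<^sup>+ x\<in>\<Omega>. (\<integral>\<^sup>+ y\<in>\<Omega>. ennreal (\<bar>strain u x y\<bar> powr p) \<partial>lborel) \<partial>lborel)"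
proof -
  define n where "n = real CARD('n)"
  have n: "0 < n" by (simp add: n_def)
  define V where "V = unit_ball_vol n * \<rho> ^ CARD('n)"
  have V: "0 < V" using assms by (simp add: V_def n_def)
  define B where "B = ball a \<rho>"
  have [measurable]: "B \<in> sets borel" by (simp add: B_def)
  have emeasure_B: "emeasure lborel B = ennreal V"
    using assms(3) by (simp add: B_def emeasure_ball V_def n_def)
  have [measurable]: "\<Omega> \<in> sets borel" using assms(1) by simp
  define c where "c = n powr p * (2 / \<rho>) powr p * n"
  have c: "0 < c" using n assms by (simp add: c_def)
  have "\<exists>(L::real^'n^'n) b.
      (\<integral>\<^sup>+ x\<in>\<Omega>. ennreal (norm (u x - (L *v x + b)) powr p) \<partial>lborel)
      \<le> ennreal (c * ((1 + n) / V)) *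
        (\<integral>\<^sup>+ x\<in>\<Omega>. (\<integral>\<^sup>+ y\<in>\<Omega>. ennreal (\<bar>strain u x y\<bar> powr p) \<partial>lborel) \<partial>lborel)"
    if [measurable]: "u \<in> borel_measurable borel" for u :: "real^'n \<Rightarrow> real^'n"
  proof -
    define F where "F y = (\<integral>\<^sup>+ x\<in>\<Omega>. ennreal (\<bar>strain u y x\<bar> powr p) \<partial>lborel)" for y
    have [measurable]: "F \<in> borel_measurable borel" unfolding F_def by measurable
    define I where "I = (\<integral>\<^sup>+ y\<in>\<Omega>. F y \<partial>lborel)"
    have shift: "(\<integral>\<^sup>+ y\<in>B. F (y + h) \<partial>lborel) \<le> I" if "norm h \<le> \<rho>" for h
      unfolding I_def
    proof (rule nn_integral_translate_subset)
      fix y assume "y \<in> B"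
      then have "dist a (y + h) < 3 * \<rho>"
        using that assms(3) norm_triangle_ineq4[of "a - y" h] by (simp add: B_def dist_norm algebra_simps)
      then show "y + h \<in> \<Omega>" using assms(2) by auto
    qed auto
    define w where "w y i = y + \<rho> *\<^sub>R axis i (1::real)" for y :: "real^'n" and i :: 'n
    have [measurable]: "(\<lambda>y. w y i) \<in> borel_measurable borel" for i
      unfolding w_def by measurable
    \<comment> \<open>Summing the strain integrals at \<open>y\<close> and at its shifts lets a
      single averaging argument choose one \<open>y\<close> that is good for all of them.\<close>
    define \<Phi> where "\<Phi> y = F y + (\<Sum>i\<in>UNIV. F (w y i))" for y
    have [measurable]: "\<Phi> \<in> borel_measurable borel" unfolding \<Phi>_def by measurable
    have "(\<integral>\<^sup>+ y\<in>B. \<Phi> y \<partial>lborel)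
        = (\<integral>\<^sup>+ y\<in>B. F (y + 0) \<partial>lborel) + (\<Sum>i\<in>UNIV. \<integral>\<^sup>+ y\<in>B. F (w y i) \<partial>lborel)"
      unfolding \<Phi>_def distrib_right sum_distrib_right
      by (subst nn_integral_add; measurable?) (subst nn_integral_sum; measurable?; simp)
    also have "\<dots> \<le> I + (\<Sum>i\<in>(UNIV::'n set). I)"
      unfolding w_def using assms(3) by (intro add_mono sum_mono shift) auto
    also have "\<dots> = ennreal (1 + n) * I"
      by (simp add: n_def distrib_right ennreal_of_nat_eq_real_of_nat)
    also have "\<dots> = (ennreal ((1 + n) / V) * I) * emeasure lborel B"
      using V n by (simp add: emeasure_B mult.commute mult.left_commute flip: ennreal_mult mult.assoc)
    finally obtain y where y: "y \<in> B" "\<Phi> y \<le> ennreal ((1 + n) / V) * I"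
      using nn_integral_exists_le_average[of \<Phi> lborel B] V by (auto simp: emeasure_B)
    \<comment> \<open>Row \<open>i\<close> of \<open>L\<close> and entry \<open>i\<close> of
      \<open>b\<close> are read off from the difference of the strains against \<open>y\<close> and
      \<open>w y i\<close>, divided by \<rho>.\<close>
    define L :: "real^'n^'n" where "L = (\<chi> i j. (u y - u (w y i)) $ j / \<rho>)"
    define b where "b = (\<chi> i. (u (w y i) \<bullet> w y i - u y \<bullet> y) / \<rho>)"
    have comp: "(u x - (L *v x + b)) $ i = (strain u x y - strain u x (w y i)) / \<rho>" for x i
    proof -
      have "(L *v x) $ i = ((u y - u (w y i)) \<bullet> x) / \<rho>"
        by (simp add: L_def matrix_vector_mult_def inner_vec_def sum_divide_distrib)
      moreover have "u x \<bullet> w y i - u x \<bullet> y = \<rho> * u x $ i"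
        by (simp add: w_def inner_add_right inner_axis)
      ultimately show ?thesis
        using assms(3)
        by (simp add: b_def strain_def inner_diff_left inner_diff_right field_simps)
    qed
    have pt: "norm (u x - (L *v x + b)) powr p
        \<le> c * (\<bar>strain u y x\<bar> powr p + (\<Sum>i\<in>UNIV. \<bar>strain u (w y i) x\<bar> powr p))" for x
    proof -
      let ?d = "u x - (L *v x + b)"
      let ?s = "\<lambda>z. \<bar>strain u z x\<bar> powr p"
      have one: "\<bar>?d $ i\<bar> powr p \<le> (2 / \<rho>) powr p * (?s y + ?s (w y i))" for i
      proof -
        have "\<bar>?d $ i\<bar> \<le> (\<bar>strain u y x\<bar> + \<bar>strain u (w y i) x\<bar>) / \<rho>"
          unfolding comp using assms(3) by (simp add: strain_commute[of u x] divide_right_mono abs_triangle_ineq4)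
        then have "\<bar>?d $ i\<bar> powr p \<le> ((\<bar>strain u y x\<bar> + \<bar>strain u (w y i) x\<bar>) / \<rho>) powr p"
          using assms(4) by (intro powr_mono2) auto
        also have "\<dots> = (\<bar>strain u y x\<bar> + \<bar>strain u (w y i) x\<bar>) powr p / \<rho> powr p"
          using assms(3) by (simp add: powr_divide)
        also have "\<dots> \<le> (2 powr p * (?s y + ?s (w y i))) / \<rho> powr p"
          using assms(4) by (intro divide_right_mono powr_add2_le) auto
        finally show ?thesis using assms(3) by (simp add: powr_divide)
      qed
      have "norm ?d powr p \<le> (\<Sum>i\<in>UNIV. \<bar>?d $ i\<bar>) powr p"
        using assms(4) by (intro powr_mono2 norm_le_l1_cart) auto
      also have "\<dots> \<le> n powr p * (\<Sum>i\<in>UNIV. \<bar>?d $ i\<bar> powr p)"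
        unfolding n_def using assms(4) by (intro powr_sum_le) auto
      also have "\<dots> \<le> n powr p * (\<Sum>i\<in>UNIV. (2 / \<rho>) powr p * (?s y + ?s (w y i)))"
        using one by (intro mult_left_mono sum_mono) auto
      also have "\<dots> = n powr p * (2 / \<rho>) powr p * (n * ?s y + (\<Sum>i\<in>UNIV. ?s (w y i)))"
        by (simp add: n_def sum.distrib sum_distrib_left[symmetric] mult.assoc)
      \<comment> \<open>Enlarging the coefficient of the shifted terms from 1 to \<open>n\<close>
        allows a common constant \<open>c\<close> to be factored out.\<close>
      also have "\<dots> \<le> n powr p * (2 / \<rho>) powr p * (n * ?s y + n * (\<Sum>i\<in>UNIV. ?s (w y i)))"
        by (intro mult_left_mono add_left_mono mult_left_mono[of 1, simplified] mult_right_mono[of 1 n, simplified])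
          (auto simp: n_def sum_nonneg Suc_leI)
      finally show ?thesis by (simp add: c_def algebra_simps)
    qed
    have "(\<integral>\<^sup>+ x\<in>\<Omega>. ennreal (norm (u x - (L *v x + b)) powr p) \<partial>lborel)
      \<le> (\<integral>\<^sup>+ x. ennreal c * (ennreal (\<bar>strain u y x\<bar> powr p) * indicator \<Omega> x
          + (\<Sum>i\<in>UNIV. ennreal (\<bar>strain u (w y i) x\<bar> powr p) * indicator \<Omega> x)) \<partial>lborel)"
    proof (rule nn_integral_mono)
      fix x
      show "ennreal (norm (u x - (L *v x + b)) powr p) * indicator \<Omega> x
        \<le> ennreal c * (ennreal (\<bar>strain u y x\<bar> powr p) * indicator \<Omega> x
          + (\<Sum>i\<in>UNIV. ennreal (\<bar>strain u (w y i) x\<bar> powr p) * indicator \<Omega> x))"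
        using ennreal_leI[OF pt[of x]] c
        by (simp add: ennreal_mult sum_nonneg split: split_indicator flip: ennreal_plus)
    qed
    also have "\<dots> = ennreal c * \<Phi> y"
      unfolding \<Phi>_def F_def
      by (subst nn_integral_cmult; measurable?)
        (subst nn_integral_add; measurable?; subst nn_integral_sum; measurable?; simp)
    also have "\<dots> \<le> ennreal c * (ennreal ((1 + n) / V) * I)"
      using y(2) by (rule mult_left_mono) simp
    also have "\<dots> = ennreal (c * ((1 + n) / V)) * I"
      using ennreal_mult'[of c "(1 + n) / V"] c by (simp only: mult.assoc less_imp_le)
    finally show ?thesis unfolding I_def F_def by blast
  qed
  then show thesis using that[of "c * ((1 + n) / V)"] c n V by simp
qed

text \<open>The mixed second difference of \<open>(L *v h) \<bullet> h\<close> in the directions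
  \<open>\<rho> * e_i\<close> and \<open>\<rho> * e_j\<close> does not depend on \<open>h\<close>
  and equals \<open>\<rho>\<^sup>2\<close> times the symmetrised entry of \<open>L\<close>.
  Averaging it over \<open>h = x - w\<close> with \<open>x\<close> and \<open>w\<close> in a small
  ball bounds that entry by the double integral.\<close>

lemma symmetric_part_le:
  fixes \<Omega> :: "(real^'n) set" and p \<rho> :: real
  assumes "open \<Omega>" "ball a (3 * \<rho>) \<subseteq> \<Omega>" "0 < \<rho>" "0 < p"
  obtains C :: real where "0 < C"
    "\<And>(L::real^'n^'n) i j. ennreal (\<bar>L $ i $ j + L $ j $ i\<bar> powr p)
      \<le> ennreal C * (\<integral>\<^sup>+ x\<in>\<Omega>. (\<integral>\<^sup>+ y\<in>\<Omega>. ennreal (\<bar>(L *v (x - y)) \<bullet> (x - y)\<bar> powr p) \<partial>lborel) \<partial>lborel)"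
proof -
  define V where "V = unit_ball_vol (real CARD('n)) * \<rho> ^ CARD('n)"
  have V: "0 < V" using assms by (simp add: V_def)
  define B where "B = ball a \<rho>"
  have [measurable]: "B \<in> sets borel" by (simp add: B_def)
  have emeasure_B: "emeasure lborel B = ennreal V"
    using assms(3) by (simp add: B_def emeasure_ball V_def)
  have [measurable]: "\<Omega> \<in> sets borel" using assms(1) by simp
  \<comment> \<open>One 4 counts the shifted integrals and \<open>4 powr p\<close> comes from the
    power inequality. The denominator collects the two averages over the ball and the factor
    \<open>\<rho>\<^sup>2\<close> of the second difference.\<close>
  define C where "C = 4 * 4 powr p / (V * V * (\<rho>\<^sup>2) powr p)"
  have "0 < C" using V assms by (simp add: C_def)
  moreover have "ennreal (\<bar>L $ i $ j + L $ j $ i\<bar> powr p)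
      \<le> ennreal C * (\<integral>\<^sup>+ x\<in>\<Omega>. (\<integral>\<^sup>+ y\<in>\<Omega>. ennreal (\<bar>(L *v (x - y)) \<bullet> (x - y)\<bar> powr p) \<partial>lborel) \<partial>lborel)"
    for L :: "real^'n^'n" and i j
  proof -
    define q where "q h = (L *v h) \<bullet> h" for h
    have [measurable]: "q \<in> borel_measurable borel" unfolding q_def by measurable
    define F where "F x = (\<integral>\<^sup>+ w\<in>\<Omega>. ennreal (\<bar>q (x - w)\<bar> powr p) \<partial>lborel)" for x
    have [measurable]: "F \<in> borel_measurable borel" unfolding F_def by measurable
    define J where "J = (\<integral>\<^sup>+ x\<in>\<Omega>. F x \<partial>lborel)"
    \<comment> \<open>The sum \<open>d i + d j\<close> used below has norm at most
      \<open>2 * \<rho>\<close>, which is why the ball inside \<Omega> has three times the radius of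
      \<open>B\<close>.\<close>
    have shift: "(\<integral>\<^sup>+ x\<in>B. F (x + h) \<partial>lborel) \<le> J" if "norm h \<le> 2 * \<rho>" for h
      unfolding J_def
    proof (rule nn_integral_translate_subset)
      fix x assume "x \<in> B"
      then have "dist a (x + h) < 3 * \<rho>"
        using that assms(3) norm_triangle_ineq4[of "a - x" h] by (simp add: B_def dist_norm algebra_simps)
      then show "x + h \<in> \<Omega>" using assms(2) by auto
    qed auto
    define d where "d i = \<rho> *\<^sub>R (axis i 1 :: real^'n)" for i :: 'n
    have nd: "norm (d i) = \<rho>" for i using assms(3) by (simp add: d_def)
    define \<sigma> where "\<sigma> = \<rho>\<^sup>2 * \<bar>L $ i $ j + L $ j $ i\<bar>"
    have entry: "(L *v d k) \<bullet> d l = \<rho>\<^sup>2 * L $ l $ k" for k l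
      by (simp add: d_def matrix_vector_mult_scaleR inner_axis matrix_vector_mul_component
          inner_axis' column_def power2_eq_square)
    have diff2: "q (h + (d i + d j)) - q (h + d i) - q (h + d j) + q h = \<rho>\<^sup>2 * (L $ i $ j + L $ j $ i)" for h
      using entry[of i j] entry[of j i]
      by (simp add: q_def matrix_vector_right_distrib inner_add_left inner_add_right algebra_simps)
    \<comment> \<open>All increments fall on \<open>x\<close> alone, and the unshifted term is
      written with \<open>x + 0\<close>, so that \<open>shift\<close> applies to each of the four
      terms.\<close>
    have pt: "ennreal (\<sigma> powr p) \<le> ennreal (4 powr p) *
        (ennreal (\<bar>q (x + (d i + d j) - w)\<bar> powr p) + ennreal (\<bar>q (x + d i - w)\<bar> powr p)
          + ennreal (\<bar>q (x + d j - w)\<bar> powr p) + ennreal (\<bar>q (x + 0 - w)\<bar> powr p))" for x w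
    proof -
      have "\<sigma> = \<bar>\<rho>\<^sup>2 * (L $ i $ j + L $ j $ i)\<bar>" by (simp add: \<sigma>_def abs_mult)
      also have "\<dots> \<le> \<bar>q (x + (d i + d j) - w)\<bar> + \<bar>q (x + d i - w)\<bar> + \<bar>q (x + d j - w)\<bar> + \<bar>q (x + 0 - w)\<bar>"
        using diff2[of "x - w", symmetric] by (simp add: algebra_simps)
      finally have "\<sigma> powr p \<le> (\<bar>q (x + (d i + d j) - w)\<bar> + \<bar>q (x + d i - w)\<bar> + \<bar>q (x + d j - w)\<bar> + \<bar>q (x + 0 - w)\<bar>) powr p"
        using assms(4) by (intro powr_mono2) (auto simp: \<sigma>_def)
      also have "\<dots> \<le> 4 powr p * (\<bar>q (x + (d i + d j) - w)\<bar> powr p + \<bar>q (x + d i - w)\<bar> powr p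
          + \<bar>q (x + d j - w)\<bar> powr p + \<bar>q (x + 0 - w)\<bar> powr p)"
        using assms(4) by (intro powr_add4_le) auto
      finally show ?thesis by (simp flip: ennreal_plus ennreal_mult)
    qed
    have B_sub: "B \<subseteq> \<Omega>"
      using assms(2,3) subset_ball[of \<rho> "3 * \<rho>" a] by (auto simp: B_def)
    have inner: "ennreal (\<sigma> powr p * V) \<le> ennreal (4 powr p) * (F (x + (d i + d j)) + F (x + d i) + F (x + d j) + F (x + 0))" for x
    proof -
      have "ennreal (\<sigma> powr p * V) = (\<integral>\<^sup>+ w\<in>B. ennreal (\<sigma> powr p) \<partial>lborel)"
        using V by (simp add: nn_integral_cmult_indicator emeasure_B ennreal_mult)
      also have "\<dots> \<le> (\<integral>\<^sup>+ w\<in>\<Omega>. ennreal (4 powr p) *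
        (ennreal (\<bar>q (x + (d i + d j) - w)\<bar> powr p) + ennreal (\<bar>q (x + d i - w)\<bar> powr p)
          + ennreal (\<bar>q (x + d j - w)\<bar> powr p) + ennreal (\<bar>q (x + 0 - w)\<bar> powr p)) \<partial>lborel)"
        using pt B_sub by (intro nn_integral_mono) (auto simp: indicator_def)
      also have "\<dots> = ennreal (4 powr p) * (F (x + (d i + d j)) + F (x + d i) + F (x + d j) + F (x + 0))"
        unfolding F_def by (simp only: mult.assoc distrib_right) (simp add: nn_integral_cmult nn_integral_add)
      finally show ?thesis .
    qed
    have "ennreal (\<sigma> powr p * V * V) = (\<integral>\<^sup>+ x\<in>B. ennreal (\<sigma> powr p * V) \<partial>lborel)"
      using V by (simp add: nn_integral_cmult_indicator emeasure_B ennreal_mult)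
    also have "\<dots> \<le> (\<integral>\<^sup>+ x\<in>B. ennreal (4 powr p) *
        (F (x + (d i + d j)) + F (x + d i) + F (x + d j) + F (x + 0)) \<partial>lborel)"
      using inner by (intro nn_integral_mono) (auto simp: indicator_def)
    also have "\<dots> = ennreal (4 powr p) * ((\<integral>\<^sup>+ x\<in>B. F (x + (d i + d j)) \<partial>lborel)
        + (\<integral>\<^sup>+ x\<in>B. F (x + d i) \<partial>lborel) + (\<integral>\<^sup>+ x\<in>B. F (x + d j) \<partial>lborel)
        + (\<integral>\<^sup>+ x\<in>B. F (x + 0) \<partial>lborel))"
      by (simp only: mult.assoc distrib_right) (simp add: nn_integral_cmult nn_integral_add)
    also have "\<dots> \<le> ennreal (4 powr p) * (J + J + J + J)"
      using assms(3) nd norm_triangle_ineq[of "d i" "d j"]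
      by (intro mult_left_mono add_mono shift) auto
    also have "\<dots> = ennreal (4 * 4 powr p) * J"
    proof -
      have "J + J + J + J = 4 * J"
        by (simp add: add.assoc mult_2[symmetric])
      then show ?thesis by (simp add: ennreal_mult mult_ac)
    qed
    finally have main: "ennreal (\<sigma> powr p * V * V) \<le> ennreal (4 * 4 powr p) * J" .
    define \<epsilon> where "\<epsilon> = 1 / (V * V * (\<rho>\<^sup>2) powr p)"
    have "0 < \<epsilon>" using V assms(3) by (simp add: \<epsilon>_def)
    have "\<bar>L $ i $ j + L $ j $ i\<bar> powr p = \<epsilon> * (\<sigma> powr p * V * V)"
      using V assms(3) by (simp add: \<epsilon>_def \<sigma>_def powr_mult)
    then have "ennreal (\<bar>L $ i $ j + L $ j $ i\<bar> powr p) = ennreal \<epsilon> * ennreal (\<sigma> powr p * V * V)"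
      using \<open>0 < \<epsilon>\<close> by (simp add: ennreal_mult')
    also have "\<dots> \<le> ennreal \<epsilon> * (ennreal (4 * 4 powr p) * J)"
      using main by (rule mult_left_mono) simp
    also have "\<dots> = ennreal C * J"
      using \<open>0 < \<epsilon>\<close> by (simp add: C_def \<epsilon>_def flip: ennreal_mult' mult.assoc)
    finally show ?thesis by (simp add: J_def F_def q_def)
  qed
  ultimately show thesis using that by blast
qed

lemma nn_integral_pair_sum:
  fixes g :: "'a::euclidean_space \<Rightarrow> ennreal"
  assumes [measurable]: "g \<in> borel_measurable borel" "\<Omega> \<in> sets borel"
  shows "(\<integral>\<^sup>+ x\<in>\<Omega>. (\<integral>\<^sup>+ y\<in>\<Omega>. (g x + g y) \<partial>lborel) \<partial>lborel)
    = 2 * emeasure lborel \<Omega> * (\<integral>\<^sup>+ x\<in>\<Omega>. g x \<partial>lborel)"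
proof -
  have "(\<integral>\<^sup>+ x\<in>\<Omega>. (\<integral>\<^sup>+ y\<in>\<Omega>. (g x + g y) \<partial>lborel) \<partial>lborel)
      = (\<integral>\<^sup>+ x\<in>\<Omega>. (\<integral>\<^sup>+ y\<in>\<Omega>. g x \<partial>lborel) \<partial>lborel) + (\<integral>\<^sup>+ x\<in>\<Omega>. (\<integral>\<^sup>+ y\<in>\<Omega>. g y \<partial>lborel) \<partial>lborel)"
    by (rule nn_integral_pair_add) measurable
  also have "(\<integral>\<^sup>+ x\<in>\<Omega>. (\<integral>\<^sup>+ y\<in>\<Omega>. g x \<partial>lborel) \<partial>lborel) = (\<integral>\<^sup>+ x. emeasure lborel \<Omega> * (g x * indicator \<Omega> x) \<partial>lborel)"
    by (simp add: nn_integral_cmult_indicator mult_ac)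
  also have "\<dots> = emeasure lborel \<Omega> * (\<integral>\<^sup>+ x\<in>\<Omega>. g x \<partial>lborel)"
    by (rule nn_integral_cmult) measurable
  also have "(\<integral>\<^sup>+ x\<in>\<Omega>. (\<integral>\<^sup>+ y\<in>\<Omega>. g y \<partial>lborel) \<partial>lborel) = emeasure lborel \<Omega> * (\<integral>\<^sup>+ x\<in>\<Omega>. g x \<partial>lborel)"
    by (subst nn_integral_cmult_indicator) (simp_all add: mult.commute)
  finally show ?thesis by (simp add: mult_2 distrib_right)
qed

text \<open>Start from an affine map \<phi> near \<open>u\<close>. Its strain is
  \<open>q (x - y)\<close> and differs from that of \<open>u\<close> only by terms in
  \<open>u - \<phi>\<close>, so the symmetric part of its matrix is small. Discarding that part
  leaves a rigid motion. Boundedness of \<Omega> allows the weight of the strain energy to be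
  inserted.\<close>

lemma korn_poincare:
  fixes \<Omega> :: "(real^'n) set" and s p :: real
  assumes "open \<Omega>" "bounded \<Omega>" "\<Omega> \<noteq> {}" "0 < p" "0 < s"
  obtains C :: real where "0 < C"
    "\<And>u :: real^'n \<Rightarrow> real^'n. u \<in> borel_measurable borel \<Longrightarrow> \<exists>r\<in>RM.
      (\<integral>\<^sup>+ x\<in>\<Omega>. ennreal (norm (u x - r x) powr p) \<partial>lborel) \<le> ennreal C * strain_energy s p \<Omega> u"
proof -
  define n where "n = real CARD('n)"
  have n: "0 < n" by (simp add: n_def)
  have [measurable]: "\<Omega> \<in> sets borel" using assms(1) by simp
  obtain a e where "0 < e" "ball a e \<subseteq> \<Omega>" using assms(1,3) by (metis openE ex_in_conv)
  define \<rho> where "\<rho> = e / 3"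
  have \<rho>: "ball a (3 * \<rho>) \<subseteq> \<Omega>" "0 < \<rho>" using \<open>0 < e\<close> \<open>ball a e \<subseteq> \<Omega>\<close> by (auto simp: \<rho>_def)
  obtain R where R: "0 < R" "\<And>x. x \<in> \<Omega> \<Longrightarrow> norm x \<le> R" using assms(2) by (auto simp: bounded_pos)
  have diam: "dist x y \<le> 2 * R" if "x \<in> \<Omega>" "y \<in> \<Omega>" for x y
    using R(2)[OF that(1)] R(2)[OF that(2)] norm_triangle_ineq4[of x y] by (simp add: dist_norm)
  obtain m where m: "0 \<le> m" "emeasure lborel \<Omega> = ennreal m"
    using emeasure_bounded_finite[OF assms(2)] by (cases "emeasure lborel \<Omega>") auto
  obtain C1 where C1: "0 < C1"
    "\<And>u :: real^'n \<Rightarrow> real^'n. u \<in> borel_measurable borel \<Longrightarrow> \<exists>(L::real^'n^'n) b.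
      (\<integral>\<^sup>+ x\<in>\<Omega>. ennreal (norm (u x - (L *v x + b)) powr p) \<partial>lborel)
      \<le> ennreal C1 * (\<integral>\<^sup>+ x\<in>\<Omega>. (\<integral>\<^sup>+ y\<in>\<Omega>. ennreal (\<bar>strain u x y\<bar> powr p) \<partial>lborel) \<partial>lborel)"
    using affine_approximation[OF assms(1) \<rho> assms(4)] by blast
  obtain C2 where C2: "0 < C2"
    "\<And>(L::real^'n^'n) i j. ennreal (\<bar>L $ i $ j + L $ j $ i\<bar> powr p)
      \<le> ennreal C2 * (\<integral>\<^sup>+ x\<in>\<Omega>. (\<integral>\<^sup>+ y\<in>\<Omega>. ennreal (\<bar>(L *v (x - y)) \<bullet> (x - y)\<bar> powr p) \<partial>lborel) \<partial>lborel)"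
    using symmetric_part_le[OF assms(1) \<rho> assms(4)] by blast
  \<comment> \<open>An upper bound for the denominator of the strain energy over all pairs of points
    in \<Omega>, whose diameter is at most \<open>2 * R\<close>.\<close>
  define c0 where "c0 = (2 * R) powr (n + s * p + p)"
  define c4 where "c4 = 3 powr p * (1 + (2 * R) powr p * (2 * m * C1))"
  define c5 where "c5 = R powr p * (n * n) powr p * (n * n * C2)"
  define C where "C = 2 powr p * (C1 + m * (c5 * c4))"
  have pos: "0 < c0" "0 < c4" "0 < c5" "0 < C"
    using R(1) m(1) C1(1) C2(1) n
    by (auto simp: c0_def c4_def c5_def C_def add_pos_nonneg)
  have "\<exists>r\<in>RM. (\<integral>\<^sup>+ x\<in>\<Omega>. ennreal (norm (u x - r x) powr p) \<partial>lborel) \<le> ennreal (C * c0) * strain_energy s p \<Omega> u"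
    if [measurable]: "u \<in> borel_measurable borel" for u :: "real^'n \<Rightarrow> real^'n"
  proof -
    define I where "I = (\<integral>\<^sup>+ x\<in>\<Omega>. (\<integral>\<^sup>+ y\<in>\<Omega>. ennreal (\<bar>strain u x y\<bar> powr p) \<partial>lborel) \<partial>lborel)"
    have I_le: "I \<le> ennreal c0 * strain_energy s p \<Omega> u"
    proof -
      let ?d = "\<lambda>x y :: real^'n. dist x y powr (n + s * p + p)"
      have pt: "ennreal (\<bar>strain u x y\<bar> powr p) \<le> ennreal c0 * ennreal (\<bar>strain u x y\<bar> powr p / ?d x y)"
        if "x \<in> \<Omega>" "y \<in> \<Omega>" for x y
      proof (cases "x = y")
        case False
        have "?d x y \<le> c0"
          unfolding c0_def using diam[OF that] assms(4,5) n by (intro powr_mono2) auto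
        then have "\<bar>strain u x y\<bar> powr p * ?d x y \<le> \<bar>strain u x y\<bar> powr p * c0"
          by (rule mult_left_mono) simp
        then have "\<bar>strain u x y\<bar> powr p \<le> c0 * (\<bar>strain u x y\<bar> powr p / ?d x y)"
          using False by (simp add: field_simps)
        then show ?thesis using pos by (simp flip: ennreal_mult)
      qed (simp add: strain_def)
      have "I \<le> (\<integral>\<^sup>+ x\<in>\<Omega>. (\<integral>\<^sup>+ y\<in>\<Omega>. ennreal c0 * ennreal (\<bar>strain u x y\<bar> powr p / ?d x y) \<partial>lborel) \<partial>lborel)"
        unfolding I_def using pt by (intro nn_integral_mono) (auto simp: indicator_def intro!: nn_integral_mono)
      also have "\<dots> = ennreal c0 * (\<integral>\<^sup>+ x\<in>\<Omega>. (\<integral>\<^sup>+ y\<in>\<Omega>. ennreal (\<bar>strain u x y\<bar> powr p / ?d x y) \<partial>lborel) \<partial>lborel)"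
        by (rule nn_integral_pair_cmult) measurable
      finally show ?thesis by (simp add: strain_energy_def n_def)
    qed
    obtain L :: "real^'n^'n" and b where Lb:
      "(\<integral>\<^sup>+ x\<in>\<Omega>. ennreal (norm (u x - (L *v x + b)) powr p) \<partial>lborel) \<le> ennreal C1 * I"
      using C1(2)[of u] unfolding I_def by auto
    define \<phi> where "\<phi> x = L *v x + b" for x
    have [measurable]: "\<phi> \<in> borel_measurable borel" unfolding \<phi>_def by measurable
    define g where "g x = ennreal (norm (u x - \<phi> x) powr p)" for x
    have [measurable]: "g \<in> borel_measurable borel" unfolding g_def by measurable
    define E where "E = (\<integral>\<^sup>+ x\<in>\<Omega>. g x \<partial>lborel)"
    have E: "E \<le> ennreal C1 * I" using Lb by (simp add: E_def g_def \<phi>_def)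
    define q where "q h = (L *v h) \<bullet> h" for h
    have [measurable]: "q \<in> borel_measurable borel" unfolding q_def by measurable
    define J where "J = (\<integral>\<^sup>+ x\<in>\<Omega>. (\<integral>\<^sup>+ y\<in>\<Omega>. ennreal (\<bar>q (x - y)\<bar> powr p) \<partial>lborel) \<partial>lborel)"
    have J: "J \<le> ennreal c4 * I"
    proof -
      have pt: "ennreal (\<bar>q (x - y)\<bar> powr p) \<le> ennreal (3 powr p) *
          (ennreal (\<bar>strain u x y\<bar> powr p) + ennreal ((2 * R) powr p) * (g x + g y))"
        if xy: "x \<in> \<Omega>" "y \<in> \<Omega>" for x y
      proof -
        let ?d = "\<lambda>x. u x - \<phi> x"
        \<comment> \<open>The left side is the strain of \<phi>, because the translation
          \<open>b\<close> cancels in differences; linearity of strain in the field gives the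
          rest.\<close>
        have "q (x - y) = strain u x y - ?d x \<bullet> (x - y) + ?d y \<bullet> (x - y)"
          by (simp add: q_def strain_def \<phi>_def matrix_vector_mult_diff_distrib inner_diff_left inner_add_left)
        moreover have "\<bar>?d z \<bullet> (x - y)\<bar> \<le> 2 * R * norm (?d z)" for z
        proof -
          have "\<bar>?d z \<bullet> (x - y)\<bar> \<le> norm (?d z) * dist x y"
            unfolding dist_norm by (rule Cauchy_Schwarz_ineq2)
          also have "\<dots> \<le> norm (?d z) * (2 * R)"
            using diam[OF xy] by (rule mult_left_mono) simp
          finally show ?thesis by (simp add: mult_ac)
        qed
        note this[of x] this[of y]
        ultimately have "\<bar>q (x - y)\<bar> \<le> \<bar>strain u x y\<bar> + 2 * R * norm (?d x) + 2 * R * norm (?d y)"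
          by linarith
        then have "\<bar>q (x - y)\<bar> powr p \<le> (\<bar>strain u x y\<bar> + 2 * R * norm (?d x) + 2 * R * norm (?d y)) powr p"
          using assms(4) by (intro powr_mono2) auto
        also have "\<dots> \<le> 3 powr p * (\<bar>strain u x y\<bar> powr p + (2 * R * norm (?d x)) powr p + (2 * R * norm (?d y)) powr p)"
          using assms(4) R(1) by (intro powr_add3_le) auto
        also have "\<dots> = 3 powr p * (\<bar>strain u x y\<bar> powr p + (2 * R) powr p * (norm (?d x) powr p + norm (?d y) powr p))"
          using R(1) powr_mult[of "2 * R" _ p] by (simp add: distrib_left)
        finally show ?thesis by (simp add: g_def flip: ennreal_plus ennreal_mult)
      qed
      have "J \<le> (\<integral>\<^sup>+ x\<in>\<Omega>. (\<integral>\<^sup>+ y\<in>\<Omega>. ennreal (3 powr p) *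
          (ennreal (\<bar>strain u x y\<bar> powr p) + ennreal ((2 * R) powr p) * (g x + g y)) \<partial>lborel) \<partial>lborel)"
        unfolding J_def using pt by (intro nn_integral_mono) (auto simp: indicator_def intro!: nn_integral_mono)
      also have "\<dots> = ennreal (3 powr p) * (\<integral>\<^sup>+ x\<in>\<Omega>. (\<integral>\<^sup>+ y\<in>\<Omega>.
          (ennreal (\<bar>strain u x y\<bar> powr p) + ennreal ((2 * R) powr p) * (g x + g y)) \<partial>lborel) \<partial>lborel)"
        by (rule nn_integral_pair_cmult) measurable
      also have "(\<integral>\<^sup>+ x\<in>\<Omega>. (\<integral>\<^sup>+ y\<in>\<Omega>.
          (ennreal (\<bar>strain u x y\<bar> powr p) + ennreal ((2 * R) powr p) * (g x + g y)) \<partial>lborel) \<partial>lborel)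
          = I + (\<integral>\<^sup>+ x\<in>\<Omega>. (\<integral>\<^sup>+ y\<in>\<Omega>. ennreal ((2 * R) powr p) * (g x + g y) \<partial>lborel) \<partial>lborel)"
        unfolding I_def by (rule nn_integral_pair_add) measurable
      also have "(\<integral>\<^sup>+ x\<in>\<Omega>. (\<integral>\<^sup>+ y\<in>\<Omega>. ennreal ((2 * R) powr p) * (g x + g y) \<partial>lborel) \<partial>lborel)
          = ennreal ((2 * R) powr p) * (\<integral>\<^sup>+ x\<in>\<Omega>. (\<integral>\<^sup>+ y\<in>\<Omega>. g x + g y \<partial>lborel) \<partial>lborel)"
        by (rule nn_integral_pair_cmult) measurable
      also have "(\<integral>\<^sup>+ x\<in>\<Omega>. (\<integral>\<^sup>+ y\<in>\<Omega>. g x + g y \<partial>lborel) \<partial>lborel) = 2 * ennreal m * E"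
        unfolding E_def m(2)[symmetric] by (rule nn_integral_pair_sum) measurable
      also have "ennreal (3 powr p) * (I + ennreal ((2 * R) powr p) * (2 * ennreal m * E))
          \<le> ennreal (3 powr p) * (I + ennreal ((2 * R) powr p) * (2 * ennreal m * (ennreal C1 * I)))"
        using E by (intro mult_left_mono add_left_mono) auto
      also have "\<dots> = ennreal c4 * I"
      proof -
        have "ennreal c4 = ennreal (3 powr p) * (1 + ennreal ((2 * R) powr p) * (2 * ennreal m * ennreal C1))"
          using m(1) C1(1) by (simp add: c4_def ennreal_mult)
        then show ?thesis by (simp only: distrib_left distrib_right mult.assoc mult_1_left mult_1_right)
      qed
      finally show ?thesis .
    qed
    \<comment> \<open>The skew part of \<open>L\<close>. With the same translation \<open>b\<close>,
      the difference \<open>\<phi> x - r x\<close> is the symmetric part of \<open>L\<close> applied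
      to \<open>x\<close>.\<close>
    define A :: "real^'n^'n" where "A = (\<chi> i j. (L $ i $ j - L $ j $ i) / 2)"
    define r where "r x = A *v x + b" for x
    have "transpose A = - A"
      by (simp add: A_def transpose_def vec_eq_iff field_simps)
    then have "r \<in> RM" unfolding RM_def r_def by blast
    have [measurable]: "r \<in> borel_measurable borel" unfolding r_def by measurable
    let ?\<sigma> = "\<lambda>(i, j). \<bar>L $ i $ j + L $ j $ i\<bar>"
    have lr: "ennreal (norm (\<phi> x - r x) powr p) \<le> ennreal c5 * J" if "x \<in> \<Omega>" for x
    proof -
      have comp: "\<bar>(\<phi> x - r x) $ i\<bar> \<le> R * (\<Sum>j\<in>UNIV. \<bar>L $ i $ j + L $ j $ i\<bar>)" for i
      proof -
        have "(\<phi> x - r x) $ i = (\<Sum>j\<in>UNIV. (L $ i $ j + L $ j $ i) / 2 * x $ j)"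
          by (simp add: \<phi>_def r_def A_def matrix_vector_mult_def sum_subtractf[symmetric] field_simps)
        also have "\<bar>\<dots>\<bar> \<le> (\<Sum>j\<in>UNIV. \<bar>(L $ i $ j + L $ j $ i) / 2 * x $ j\<bar>)" by (rule sum_abs)
        also have "\<dots> \<le> (\<Sum>j\<in>UNIV. \<bar>L $ i $ j + L $ j $ i\<bar> * R)"
        proof (rule sum_mono)
          fix j
          have "\<bar>x $ j\<bar> \<le> R" using component_le_norm_cart[of x j] R(2)[OF that] by simp
          then show "\<bar>(L $ i $ j + L $ j $ i) / 2 * x $ j\<bar> \<le> \<bar>L $ i $ j + L $ j $ i\<bar> * R"
            unfolding abs_mult by (intro mult_mono) auto
        qed
        finally show ?thesis by (simp add: sum_distrib_left mult_ac)
      qed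
      have "norm (\<phi> x - r x) \<le> (\<Sum>i\<in>UNIV. \<bar>(\<phi> x - r x) $ i\<bar>)" by (rule norm_le_l1_cart)
      also have "\<dots> \<le> (\<Sum>i\<in>UNIV. R * (\<Sum>j\<in>UNIV. \<bar>L $ i $ j + L $ j $ i\<bar>))"
        using comp by (rule sum_mono)
      also have "\<dots> = R * (\<Sum>k\<in>UNIV \<times> UNIV. ?\<sigma> k)"
        by (simp add: sum_distrib_left sum.cartesian_product split_def)
      finally have "norm (\<phi> x - r x) powr p \<le> (R * (\<Sum>k\<in>UNIV \<times> UNIV. ?\<sigma> k)) powr p"
        using assms(4) by (intro powr_mono2) auto
      also have "\<dots> = R powr p * (\<Sum>k\<in>UNIV \<times> UNIV. ?\<sigma> k) powr p"
        using R(1) by (intro powr_mult)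
      also have "\<dots> \<le> R powr p * (real (card (UNIV \<times> UNIV :: ('n \<times> 'n) set)) powr p * (\<Sum>k\<in>UNIV \<times> UNIV. ?\<sigma> k powr p))"
        using assms(4) by (intro mult_left_mono powr_sum_le) auto
      also have "\<dots> = R powr p * (n * n) powr p * (\<Sum>k\<in>UNIV \<times> UNIV. ?\<sigma> k powr p)"
        by (simp add: n_def card_cartesian_product)
      finally have "ennreal (norm (\<phi> x - r x) powr p)
          \<le> ennreal (R powr p * (n * n) powr p * (\<Sum>k\<in>UNIV \<times> UNIV. ?\<sigma> k powr p))"
        by (rule ennreal_leI)
      also have "\<dots> = ennreal (R powr p * (n * n) powr p) * (\<Sum>k\<in>UNIV \<times> UNIV. ennreal (?\<sigma> k powr p))"
        by (simp add: ennreal_mult sum_nonneg)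
      also have "\<dots> \<le> ennreal (R powr p * (n * n) powr p) * (\<Sum>k\<in>(UNIV \<times> UNIV :: ('n \<times> 'n) set). ennreal C2 * J)"
        using C2(2)[of L] by (intro mult_left_mono sum_mono) (auto simp: J_def q_def)
      also have "\<dots> = ennreal (R powr p * (n * n) powr p) * (ennreal (n * n) * (ennreal C2 * J))"
        by (simp add: n_def card_cartesian_product ennreal_of_nat_eq_real_of_nat ennreal_mult)
      also have "\<dots> = ennreal c5 * J"
        using n C2(1) by (simp add: c5_def ennreal_mult mult.assoc)
      finally show ?thesis .
    qed
    have "(\<integral>\<^sup>+ x\<in>\<Omega>. ennreal (norm (u x - r x) powr p) \<partial>lborel)
        \<le> (\<integral>\<^sup>+ x. ennreal (2 powr p) * (g x * indicator \<Omega> x + ennreal c5 * J * indicator \<Omega> x) \<partial>lborel)"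
    proof (rule nn_integral_mono)
      fix x
      show "ennreal (norm (u x - r x) powr p) * indicator \<Omega> x
          \<le> ennreal (2 powr p) * (g x * indicator \<Omega> x + ennreal c5 * J * indicator \<Omega> x)"
      proof (cases "x \<in> \<Omega>")
        case True
        have "norm (u x - r x) powr p \<le> (norm (u x - \<phi> x) + norm (\<phi> x - r x)) powr p"
          using assms(4) norm_triangle_ineq[of "u x - \<phi> x" "\<phi> x - r x"] by (intro powr_mono2) auto
        also have "\<dots> \<le> 2 powr p * (norm (u x - \<phi> x) powr p + norm (\<phi> x - r x) powr p)"
          using assms(4) by (intro powr_add2_le) auto
        finally have "ennreal (norm (u x - r x) powr p)
            \<le> ennreal (2 powr p) * (g x + ennreal (norm (\<phi> x - r x) powr p))"
          by (simp add: g_def flip: ennreal_plus ennreal_mult)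
        also have "\<dots> \<le> ennreal (2 powr p) * (g x + ennreal c5 * J)"
          using lr[OF True] by (intro mult_left_mono add_left_mono) auto
        finally show ?thesis using True by simp
      qed simp
    qed
    also have "\<dots> = ennreal (2 powr p) * (\<integral>\<^sup>+ x. g x * indicator \<Omega> x + ennreal c5 * J * indicator \<Omega> x \<partial>lborel)"
      by (rule nn_integral_cmult) measurable
    also have "(\<integral>\<^sup>+ x. g x * indicator \<Omega> x + ennreal c5 * J * indicator \<Omega> x \<partial>lborel)
        = E + (\<integral>\<^sup>+ x. ennreal c5 * J * indicator \<Omega> x \<partial>lborel)"
      unfolding E_def by (rule nn_integral_add) measurable
    also have "(\<integral>\<^sup>+ x. ennreal c5 * J * indicator \<Omega> x \<partial>lborel) = ennreal c5 * J * ennreal m"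
      by (simp add: nn_integral_cmult_indicator m(2))
    also have "ennreal (2 powr p) * (E + ennreal c5 * J * ennreal m)
        \<le> ennreal (2 powr p) * (ennreal C1 * I + ennreal c5 * (ennreal c4 * I) * ennreal m)"
      using E J by (intro mult_left_mono add_mono mult_right_mono) auto
    also have "\<dots> = ennreal C * I"
    proof -
      have "ennreal C = ennreal (2 powr p) * (ennreal C1 + ennreal m * (ennreal c5 * ennreal c4))"
        using m(1) C1(1) pos by (simp add: C_def ennreal_mult)
      then show ?thesis by (simp only: distrib_left distrib_right mult_ac)
    qed
    also have "\<dots> \<le> ennreal C * (ennreal c0 * strain_energy s p \<Omega> u)"
      using I_le by (rule mult_left_mono) simp
    also have "\<dots> = ennreal (C * c0) * strain_energy s p \<Omega> u"
      using pos by (simp add: ennreal_mult mult.assoc)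
    finally show ?thesis using \<open>r \<in> RM\<close> by blast
  qed
  then show thesis using that[of "C * c0"] pos by simp
qed

subsection \<open>The fractional Korn inequality\<close>

text \<open>Cauchy-Schwarz contributes the factor \<open>dist x y powr p\<close> by which the two
  weights differ. The comparison makes the strain energy of a field in \<open>Wsp\<close> finite, so
  that \<open>enn2real\<close> does not collapse it to 0.\<close>

lemma strain_energy_le_gagliardo_energy:
  assumes "0 < p"
  shows "strain_energy s p \<Omega> u \<le> gagliardo_energy s p \<Omega> u"
proof -
  have "\<bar>strain u x y\<bar> powr p / dist x y powr (real DIM('a) + s * p + p)
      \<le> norm (u x - u y) powr p / dist x y powr (real DIM('a) + s * p)" for x y :: 'a
  proof (cases "x = y")
    case False
    have "\<bar>strain u x y\<bar> \<le> norm (u x - u y) * dist x y"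
      unfolding strain_def dist_norm by (rule Cauchy_Schwarz_ineq2)
    then have "\<bar>strain u x y\<bar> powr p \<le> (norm (u x - u y) * dist x y) powr p"
      using assms by (intro powr_mono2) auto
    also have "\<dots> = norm (u x - u y) powr p * dist x y powr p"
      by (simp add: powr_mult)
    finally have "\<bar>strain u x y\<bar> powr p / (dist x y powr (real DIM('a) + s * p) * dist x y powr p)
        \<le> norm (u x - u y) powr p * dist x y powr p / (dist x y powr (real DIM('a) + s * p) * dist x y powr p)"
      by (rule divide_right_mono) simp
    then show ?thesis using False unfolding powr_add[of "dist x y" "real DIM('a) + s * p" p] by simp
  qed simp
  then show ?thesis
    unfolding strain_energy_def gagliardo_energy_def
    by (intro nn_integral_mono mult_right_mono ennreal_leI) auto
qed

text \<open>The quadratic form of a skew-symmetric matrix vanishes, so a rigid motion has zero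
  strain.\<close>

lemma strain_diff_RM:
  fixes u r :: "real^'n \<Rightarrow> real^'n"
  assumes "r \<in> RM"
  shows "strain (\<lambda>x. u x - r x) x y = strain u x y"
proof -
  obtain A :: "real^'n^'n" and b where A: "transpose A = - A" and r: "r = (\<lambda>x. A *v x + b)"
    using assms unfolding RM_def by blast
  have skew: "(A *v h) \<bullet> h = 0" for h
  proof -
    have "(A *v h) \<bullet> h = h \<bullet> (transpose A *v h)"
      by (simp add: dot_lmul_matrix[symmetric] inner_commute)
    also have "\<dots> = - ((A *v h) \<bullet> h)"
      unfolding A by (simp add: matrix_vector_mult_def vec_eq_iff inner_vec_def sum_negf mult.commute)
    finally show ?thesis by simp
  qed
  have "u x - r x - (u y - r y) = (u x - u y) - A *v (x - y)"
    by (simp add: r matrix_vector_mult_diff_distrib)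
  then have "strain (\<lambda>x. u x - r x) x y = strain u x y - (A *v (x - y)) \<bullet> (x - y)"
    unfolding strain_def by (simp only: inner_diff_left)
  then show ?thesis by (simp add: skew)
qed

section \<open>Borel representatives and the passage from Lebesgue to Borel integrals\<close>

text \<open>Extended by 0 outside \<Omega>, each component is Lebesgue measurable and agrees almost
  everywhere with a Borel function. Finitely many exceptional null sets still have a null
  union.\<close>

lemma borel_representative:
  fixes u :: "real^'n \<Rightarrow> real^'n"
  assumes "u \<in> borel_measurable (lebesgue_on \<Omega>)" "\<Omega> \<in> sets lebesgue"
  obtains v where "v \<in> borel_measurable borel" "AE x in lborel. x \<in> \<Omega> \<longrightarrow> u x = v x"
proof -
  have "\<exists>g\<in>borel_measurable lborel. AE x in lborel. (if x \<in> \<Omega> then u x else 0) $ i = g x" for i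
  proof (rule completion_ex_borel_measurable_real)
    show "(\<lambda>x. (if x \<in> \<Omega> then u x else 0) $ i) \<in> borel_measurable lebesgue"
      using borel_measurable_if_I[OF assms]
      by (rule measurable_compose) (intro borel_measurable_continuous_onI continuous_intros)
  qed
  then have "\<forall>i. \<exists>h. h \<in> borel_measurable lborel \<and>
      (AE x in lborel. (if x \<in> \<Omega> then u x else 0) $ i = h x)"
    by (simp only: Bex_def) simp
  from choice[OF this] obtain g where g: "\<And>i. g i \<in> borel_measurable lborel"
    "\<And>i. AE x in lborel. (if x \<in> \<Omega> then u x else 0) $ i = g i x"
    by blast
  define v where "v x = (\<chi> i. g i x)" for x
  have v: "v \<in> borel_measurable borel"
    using g(1) by (subst borel_measurable_euclidean_space)
      (auto simp: v_def Basis_vec_def inner_axis)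
  have "AE x in lborel. \<forall>i. (if x \<in> \<Omega> then u x else 0) $ i = g i x"
    using g(2) by (simp add: AE_all_countable)
  then have "AE x in lborel. x \<in> \<Omega> \<longrightarrow> u x = v x"
    by eventually_elim (auto simp: v_def vec_eq_iff)
  with v show thesis by (rule that)
qed

text \<open>Integrals over the completed measure agree with those over \<open>lborel\<close>, and
  the change from \<open>u\<close> to \<open>v\<close> is made almost everywhere in each variable
  separately. With the integrand left as a parameter \<open>F\<close>, one statement serves both
  seminorms.\<close>

lemma double_integral_lebesgue_eq_lborel:
  assumes "AE x in lborel. x \<in> \<Omega> \<longrightarrow> u x = v x"
  shows "(\<integral>\<^sup>+ x\<in>\<Omega>. (\<integral>\<^sup>+ y\<in>\<Omega>. F x y (u x) (u y) \<partial>lebesgue) \<partial>lebesgue)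
    = (\<integral>\<^sup>+ x\<in>\<Omega>. (\<integral>\<^sup>+ y\<in>\<Omega>. F x y (v x) (v y) \<partial>lborel) \<partial>lborel)"
  unfolding nn_integral_completion
proof (rule nn_integral_cong_AE, use assms in eventually_elim)
  case (elim x)
  have "(\<integral>\<^sup>+ y\<in>\<Omega>. F x y (u x) (u y) \<partial>lborel) = (\<integral>\<^sup>+ y\<in>\<Omega>. F x y (v x) (v y) \<partial>lborel)" if "x \<in> \<Omega>"
  proof (rule nn_integral_cong_AE, use assms in eventually_elim)
    case (elim y)
    with \<open>x \<in> \<Omega> \<longrightarrow> u x = v x\<close> that show ?case by (auto simp: indicator_def)
  qed
  then show ?case by (auto simp: indicator_def)
qed

lemma W_seminorm_eq:
  fixes u v :: "real^'n \<Rightarrow> real^'n"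
  assumes "AE x in lborel. x \<in> \<Omega> \<longrightarrow> u x = v x"
  shows "W_seminorm s p \<Omega> u = enn2real (gagliardo_energy s p \<Omega> v) powr (1 / p)"
  unfolding W_seminorm_def gagliardo_energy_def
  by (subst double_integral_lebesgue_eq_lborel[OF assms, where
        F = "\<lambda>x y a b. ennreal (norm (a - b) powr p / dist x y powr (real CARD('n) + s * p))"]) simp

lemma X_seminorm_eq:
  fixes u v :: "real^'n \<Rightarrow> real^'n"
  assumes "AE x in lborel. x \<in> \<Omega> \<longrightarrow> u x = v x"
  shows "X_seminorm s p \<Omega> u = enn2real (strain_energy s p \<Omega> v) powr (1 / p)"
proof -
  have "strain v x y = (v y - v x) \<bullet> (y - x)" for x y
    by (subst strain_commute) (simp add: strain_def)
  then show ?thesis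
    unfolding X_seminorm_def strain_energy_def
    by (subst double_integral_lebesgue_eq_lborel[OF assms, where
          F = "\<lambda>x y a b. ennreal (\<bar>(b - a) \<bullet> (y - x)\<bar> powr p / dist y x powr (real CARD('n) + s * p + p))"])
      (simp add: dist_commute)
qed

theorem theorem6p1:
  fixes \<Omega> :: "(real^'n) set" and s p :: real
  assumes "bounded \<Omega>" and "is_uniform_domain \<Omega>"
    and "1 < p" and "0 < s" and "s < 1"
  shows "\<exists>C>1. \<forall>u \<in> Wsp s p \<Omega>.
           (INF r\<in>RM. W_seminorm s p \<Omega> (\<lambda>x. u x - r x)) \<le> C * X_seminorm s p \<Omega> u"
proof -
  obtain c where c: "1 \<le> c" "uniform_domain \<Omega> c" using assms(2) by (auto simp: is_uniform_domain_def)
  then have \<Omega>: "open \<Omega>" "\<Omega> \<noteq> {}" by (auto simp: uniform_domain_def)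
  have [measurable]: "\<Omega> \<in> sets borel" using \<Omega>(1) by simp
  have p: "0 < p" using assms(3) by simp
  obtain \<delta> where \<delta>: "0 < \<delta>"
    "\<And>x \<tau>. \<lbrakk>x \<in> \<Omega>; 0 < \<tau>; \<tau> \<le> \<delta>\<rbrakk> \<Longrightarrow> \<exists>a. ball a (\<tau> / c) \<subseteq> \<Omega> \<inter> cball x (2 * \<tau>)"
    using uniform_domain_corkscrew[OF c(2)] by blast
  have "0 < 1 / c" using c(1) by simp
  have "\<exists>C>0. \<forall>v\<in>borel_measurable borel. gagliardo_energy s p \<Omega> v < \<infinity> \<longrightarrow>
      gagliardo_energy s p \<Omega> v \<le> ennreal C * (strain_energy s p \<Omega> v
        + (\<integral>\<^sup>+ x\<in>\<Omega>. (\<integral>\<^sup>+ y\<in>\<Omega>. ennreal (norm (v x - v y) powr p) \<partial>lborel) \<partial>lborel))"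
    by (rule gagliardo_energy_le_strain_energy[OF \<Omega>(1) \<open>0 < 1 / c\<close> \<delta>(1) p assms(4,5)])
      (use \<delta>(2) in simp)
  then obtain C1 where C1: "0 < C1"
    "\<And>v. \<lbrakk>v \<in> borel_measurable borel; gagliardo_energy s p \<Omega> v < \<infinity>\<rbrakk> \<Longrightarrow>
      gagliardo_energy s p \<Omega> v \<le> ennreal C1 * (strain_energy s p \<Omega> v
        + (\<integral>\<^sup>+ x\<in>\<Omega>. (\<integral>\<^sup>+ y\<in>\<Omega>. ennreal (norm (v x - v y) powr p) \<partial>lborel) \<partial>lborel))"
    by blast
  obtain C2 where C2: "0 < C2"
    "\<And>u :: real^'n \<Rightarrow> real^'n. u \<in> borel_measurable borel \<Longrightarrow> \<exists>r\<in>RM.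
      (\<integral>\<^sup>+ x\<in>\<Omega>. ennreal (norm (u x - r x) powr p) \<partial>lborel) \<le> ennreal C2 * strain_energy s p \<Omega> u"
    using korn_poincare[OF \<Omega>(1) assms(1) \<Omega>(2) p assms(4)] by blast
  obtain m where m: "0 \<le> m" "emeasure lborel \<Omega> = ennreal m"
    using emeasure_bounded_finite[OF assms(1)] by (cases "emeasure lborel \<Omega>") auto
  define C where "C = C1 * (1 + 2 powr p * (2 * m * C2))"
  have C: "0 < C" using C1(1) C2(1) m(1) by (simp add: C_def add_pos_nonneg)
  \<comment> \<open>Adding 2 to the constant ensures that it exceeds 1, whatever the size of
    \<open>C\<close>.\<close>
  have korn: "(INF r\<in>RM. W_seminorm s p \<Omega> (\<lambda>x. u x - r x)) \<le> (C powr (1 / p) + 2) * X_seminorm s p \<Omega> u"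
    if u: "u \<in> Wsp s p \<Omega>" for u
  proof -
    have "u \<in> borel_measurable (lebesgue_on \<Omega>)" "\<Omega> \<in> sets lebesgue"
      using u \<Omega>(1) by (simp_all add: Wsp_def)
    from borel_representative[OF this] obtain u' where u' [measurable]: "u' \<in> borel_measurable borel"
      and ae: "AE x in lborel. x \<in> \<Omega> \<longrightarrow> u x = u' x"
      by blast
    have "gagliardo_energy s p \<Omega> u' < \<infinity>"
      using u double_integral_lebesgue_eq_lborel[OF ae, where
        F = "\<lambda>x y a b. ennreal (norm (a - b) powr p / dist x y powr (real CARD('n) + s * p))"]
      by (simp add: Wsp_def gagliardo_energy_def)
    then have fin: "strain_energy s p \<Omega> u' < \<infinity>"
      using strain_energy_le_gagliardo_energy[OF p] by (rule le_less_trans[rotated])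
    obtain r where r: "r \<in> RM"
      "(\<integral>\<^sup>+ x\<in>\<Omega>. ennreal (norm (u' x - r x) powr p) \<partial>lborel) \<le> ennreal C2 * strain_energy s p \<Omega> u'"
      using C2(2)[OF u'] by blast
    define v where "v = (\<lambda>x. u' x - r x)"
    obtain A :: "real^'n^'n" and b where rAb: "r = (\<lambda>x. A *v x + b)"
      using r(1) unfolding RM_def by blast
    have [measurable]: "r \<in> borel_measurable borel" unfolding rAb by measurable
    have [measurable]: "v \<in> borel_measurable borel" unfolding v_def by measurable
    have strain_v: "strain_energy s p \<Omega> v = strain_energy s p \<Omega> u'"
      unfolding strain_energy_def v_def strain_diff_RM[OF r(1)] ..
    have "AE x in lborel. x \<in> \<Omega> \<longrightarrow> u x - r x = v x"
      using ae by eventually_elim (simp add: v_def)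
    then have W: "W_seminorm s p \<Omega> (\<lambda>x. u x - r x) = enn2real (gagliardo_energy s p \<Omega> v) powr (1 / p)"
      by (rule W_seminorm_eq)
    have X: "X_seminorm s p \<Omega> u = enn2real (strain_energy s p \<Omega> u') powr (1 / p)"
      using ae by (rule X_seminorm_eq)
    \<comment> \<open>After subtraction of \<open>r\<close> the field is itself small in the
      \<open>p\<close>-th mean, so its differences are too: each of the two points contributes the
      measure \<open>m\<close> times the integral of \<open>norm (v x) powr p\<close>.\<close>
    have pairs: "(\<integral>\<^sup>+ x\<in>\<Omega>. (\<integral>\<^sup>+ y\<in>\<Omega>. ennreal (norm (v x - v y) powr p) \<partial>lborel) \<partial>lborel)
        \<le> ennreal (2 powr p * (2 * m * C2)) * strain_energy s p \<Omega> v"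
    proof -
      define g where "g x = ennreal (norm (v x) powr p)" for x
      have [measurable]: "g \<in> borel_measurable borel" unfolding g_def by measurable
      have g_le: "(\<integral>\<^sup>+ x\<in>\<Omega>. g x \<partial>lborel) \<le> ennreal C2 * strain_energy s p \<Omega> v"
        unfolding strain_v using r(2) by (simp add: g_def v_def)
      have "ennreal (norm (v x - v y) powr p) \<le> ennreal (2 powr p) * (g x + g y)" for x y
      proof -
        have "norm (v x - v y) powr p \<le> (norm (v x) + norm (v y)) powr p"
          using p by (intro powr_mono2 norm_triangle_ineq4) auto
        also have "\<dots> \<le> 2 powr p * (norm (v x) powr p + norm (v y) powr p)"
          using p by (intro powr_add2_le) auto
        finally show ?thesis by (simp add: g_def flip: ennreal_plus ennreal_mult)
      qed
      then have "(\<integral>\<^sup>+ x\<in>\<Omega>. (\<integral>\<^sup>+ y\<in>\<Omega>. ennreal (norm (v x - v y) powr p) \<partial>lborel) \<partial>lborel)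
          \<le> (\<integral>\<^sup>+ x\<in>\<Omega>. (\<integral>\<^sup>+ y\<in>\<Omega>. ennreal (2 powr p) * (g x + g y) \<partial>lborel) \<partial>lborel)"
        by (intro nn_integral_mono mult_right_mono) auto
      also have "\<dots> = ennreal (2 powr p) * (\<integral>\<^sup>+ x\<in>\<Omega>. (\<integral>\<^sup>+ y\<in>\<Omega>. (g x + g y) \<partial>lborel) \<partial>lborel)"
        by (rule nn_integral_pair_cmult) measurable
      also have "\<dots> = ennreal (2 powr p) * (2 * ennreal m * (\<integral>\<^sup>+ x\<in>\<Omega>. g x \<partial>lborel))"
        by (simp add: nn_integral_pair_sum m(2))
      also have "\<dots> \<le> ennreal (2 powr p) * (2 * ennreal m * (ennreal C2 * strain_energy s p \<Omega> v))"
        by (intro mult_left_mono g_le) simp_all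
      also have "\<dots> = ennreal (2 powr p * (2 * m * C2)) * strain_energy s p \<Omega> v"
      proof -
        have "ennreal (2 powr p * (2 * m * C2)) = ennreal (2 powr p) * (2 * ennreal m * ennreal C2)"
          using m(1) C2(1) by (simp add: ennreal_mult)
        then show ?thesis by (simp only: mult.assoc)
      qed
      finally show ?thesis .
    qed
    have "W_seminorm s p \<Omega> (\<lambda>x. u x - r x) \<le> C powr (1 / p) * X_seminorm s p \<Omega> u"
    proof (cases "gagliardo_energy s p \<Omega> v = \<infinity>")
      case False
      then have "gagliardo_energy s p \<Omega> v < \<infinity>" by (simp add: less_top)
      have "gagliardo_energy s p \<Omega> v \<le> ennreal C1 * (strain_energy s p \<Omega> v
        + (\<integral>\<^sup>+ x\<in>\<Omega>. (\<integral>\<^sup>+ y\<in>\<Omega>. ennreal (norm (v x - v y) powr p) \<partial>lborel) \<partial>lborel))"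
        by (rule C1(2)) fact+
      also have "\<dots> \<le> ennreal C1 * (strain_energy s p \<Omega> v
          + ennreal (2 powr p * (2 * m * C2)) * strain_energy s p \<Omega> v)"
        using pairs by (intro mult_left_mono add_left_mono) auto
      also have "\<dots> = ennreal C * strain_energy s p \<Omega> v"
      proof -
        have "ennreal C = ennreal C1 * (1 + ennreal (2 powr p * (2 * m * C2)))"
          using ennreal_mult'[of C1 "1 + 2 powr p * (2 * m * C2)"]
            ennreal_plus[of 1 "2 powr p * (2 * m * C2)"] C1(1) C2(1) m(1)
          by (simp add: C_def)
        then show ?thesis by (simp only: distrib_left distrib_right mult.assoc mult_1_left mult_1_right)
      qed
      finally have "gagliardo_energy s p \<Omega> v \<le> ennreal C * strain_energy s p \<Omega> u'"
        unfolding strain_v .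
      \<comment> \<open>Monotonicity of \<open>enn2real\<close> requires the larger side to be
        finite, which \<open>fin\<close> supplies.\<close>
      then have "enn2real (gagliardo_energy s p \<Omega> v) \<le> enn2real (ennreal C * strain_energy s p \<Omega> u')"
        using fin by (intro enn2real_mono) (simp_all add: ennreal_mult_less_top)
      also have "\<dots> = C * enn2real (strain_energy s p \<Omega> u')"
        using C by (simp add: enn2real_mult)
      finally have "enn2real (gagliardo_energy s p \<Omega> v) powr (1 / p)
          \<le> (C * enn2real (strain_energy s p \<Omega> u')) powr (1 / p)"
        using p by (intro powr_mono2) simp_all
      then show ?thesis unfolding W X using C by (simp add: powr_mult)
    next
      case True
      \<comment> \<open>Cannot happen on a bounded domain, but \<open>W_seminorm\<close> is then \<open>0\<close> anyway.\<close>
      then show ?thesis by (simp add: W X)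
    qed
    also have "\<dots> \<le> (C powr (1 / p) + 2) * X_seminorm s p \<Omega> u"
      by (rule mult_right_mono) (simp_all add: X)
    finally have le: "W_seminorm s p \<Omega> (\<lambda>x. u x - r x) \<le> (C powr (1 / p) + 2) * X_seminorm s p \<Omega> u" .
    \<comment> \<open>The infimum of reals lies below each of its members only for a family bounded
      below; the seminorms are nonnegative.\<close>
    have "bdd_below ((\<lambda>r. W_seminorm s p \<Omega> (\<lambda>x. u x - r x)) ` RM)"
      by (intro bdd_belowI2[of _ 0]) (simp add: W_seminorm_def)
    then show ?thesis by (rule cINF_lower2[OF _ r(1)]) (rule le)
  qed
  have "1 < C powr (1 / p) + 2"
    by (rule add_strict_increasing2) simp_all
  show ?thesis
  proof (intro exI conjI ballI)
    show "1 < C powr (1 / p) + 2" by fact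
  qed (rule korn)
qed

end
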